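(* Let $m\geq2$, let $1\leq p_i\leq\infty$ for $i=1,2,\dots,m$, and let $\frac{1}{p}=\sum_{i=1}^{m}\frac{1}{p_i}$. Suppose that there are distinct $j,k\in\{1,2,\dots,m\}$ such that $\left(\frac{1}{p_1},\dots,\frac{1}{p_m}\right)$ belongs to the closed line segment $$L_{k,j}=\left\{\left(\tfrac{1}{p_1},\dots,\tfrac{1}{p_m}\right):\ 0\leq \tfrac{1}{p_k}\leq\tfrac{1}{2},\ \tfrac{1}{p_j}=\tfrac{1}{2},\ \tfrac{1}{p_i}=1\ \text{ for all } i\neq k,j\right\}.$$ Then there exists $C>0$ such that $$\Vert \mathcal{S}^{m}(f_1,f_2,\dots,f_m)\Vert_{L^{p,\infty}(\mathbb{R})}\leq C\prod_{i=1}^{m}\Vert f_i\Vert_{L^{p_i,1}(\mathbb{R})}$$ for all $f_1,\dots,f_m$.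
   Context: For $f_1,\dots,f_m$ in the Schwartz class $\mathcal{S}(\mathbb{R})$, the multilinear spherical maximal function is $$\mathcal{S}^{m}(f_1,f_2,\dots,f_m)(x)=\sup_{t>0}\Big|\int_{\mathbb{S}^{m-1}}\prod_{i=1}^{m}f_i(x-ty_i)\,d\sigma_{m-1}(\vec{y})\Big|,\qquad x\in\mathbb{R},$$ where $\vec y=(y_1,\dots,y_m)$ and $\sigma_{m-1}$ is the normalized surface measure on the unit sphere $\mathbb{S}^{m-1}\subset\mathbb{R}^m$. $L^{p,s}$ denotes the Lorentz space; $L^{\infty,1}$ is interpreted as $L^\infty$. *)

theory Defs
  imports "HOL-Analysis.Analysis" "HOL-Probability.Probability"
begin

section \<open>Schwartz class on the line\<close>

text \<open>\<^term>\<open>D n\<close> is the \<open>n\<close>-th derivative of \<^term>\<open>f\<close>, so its existence for all \<open>n\<close> says that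
  \<^term>\<open>f\<close> is smooth.\<close>

definition schwartz :: "(real \<Rightarrow> complex) \<Rightarrow> bool" where
  "schwartz f \<longleftrightarrow>
     (\<exists>D :: nat \<Rightarrow> real \<Rightarrow> complex.
        D 0 = f \<and>
        (\<forall>n x. (D n has_vector_derivative D (Suc n) x) (at x)) \<and>
        (\<forall>k n. \<exists>B. \<forall>x. \<bar>x\<bar> ^ k * cmod (D n x) \<le> B))"

section \<open>Normalized surface measure on the unit sphere\<close>

text \<open>The surface measure of a Borel subset \<open>A\<close> of the unit sphere is the dimension times the
  Lebesgue measure of the cone \<open>{r y | 0 < r \<le> 1, y \<in> A}\<close>; hence the normalized surface measure of
  \<open>A\<close> is the proportion of the unit ball occupied by that cone. Since \<open>sgn x = x / norm x\<close>, it is the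
  law of \<open>sgn x\<close> for \<open>x\<close> uniform in the unit ball. It is a measure on the Borel sets of the whole
  space, carried by the sphere. The last lemma below, invariance under the orthogonal group,
  characterizes it among the probability measures carried by the sphere (the index type is
  wellordered there only because the library's theorem on orthogonal images requires it).\<close>

definition sphere_measure :: "'a::euclidean_space measure" where
  "sphere_measure = distr (uniform_measure lborel (cball 0 1)) borel sgn"

lemma sets_sphere_measure [simp, measurable_cong]: "sets sphere_measure = sets borel"
  by (simp add: sphere_measure_def)

lemma space_sphere_measure [simp]: "space sphere_measure = UNIV"
  by (simp add: sphere_measure_def)

lemma sgn_measurable_euclidean [measurable]:
  "(sgn :: 'a::euclidean_space \<Rightarrow> 'a) \<in> borel_measurable borel"
  unfolding sgn_div_norm by measurable

lemma emeasure_unit_cball: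
  "emeasure lborel (cball (0::'a::euclidean_space) 1) \<noteq> 0"
  "emeasure lborel (cball (0::'a::euclidean_space) 1) \<noteq> \<infinity>"
proof -
  have "measure lborel (cball (0::'a) 1) > 0"
    by (rule content_cball_pos) simp
  then show "emeasure lborel (cball (0::'a) 1) \<noteq> 0"
    by (auto simp: measure_def)
  show "emeasure lborel (cball (0::'a) 1) \<noteq> \<infinity>"
    using emeasure_bounded_finite[of "cball (0::'a) 1"] by simp
qed

lemma emeasure_sphere_measure:
  fixes A :: "'a::euclidean_space set"
  assumes [measurable]: "A \<in> sets borel"
  shows "emeasure sphere_measure A =
    emeasure lborel (cball 0 1 \<inter> sgn -` A) / emeasure lborel (cball (0::'a) 1)"
proof -
  have [measurable]: "sgn -` A \<in> sets borel"
    using measurable_sets[OF sgn_measurable_euclidean assms] by simp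
  show ?thesis
    by (simp add: sphere_measure_def emeasure_distr)
qed

lemma prob_space_sphere_measure: "prob_space (sphere_measure :: 'a::euclidean_space measure)"
proof (rule prob_spaceI)
  show "emeasure sphere_measure (space (sphere_measure :: 'a measure)) = 1"
    using emeasure_unit_cball[where 'a='a]
    by (simp add: emeasure_sphere_measure ennreal_divide_self top.not_eq_extremum)
qed

lemma AE_sphere_measure: "AE y in sphere_measure. y \<in> sphere (0::'a::euclidean_space) 1"
proof (rule AE_I')
  have "cball 0 1 \<inter> sgn -` (- sphere (0::'a) 1) \<subseteq> {0}"
    by (auto simp: norm_sgn split: if_splits)
  then have "emeasure lborel (cball 0 1 \<inter> sgn -` (- sphere (0::'a) 1)) \<le> emeasure lborel {0::'a}"
    by (rule emeasure_mono) simp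
  then have "emeasure sphere_measure (- sphere (0::'a) 1) = 0"
    by (simp add: emeasure_sphere_measure)
  then show "- sphere (0::'a) 1 \<in> null_sets sphere_measure"
    by (simp add: null_sets_def)
qed auto

lemma sphere_measure_orthogonal:
  fixes T :: "real ^ 'm::{finite,wellorder} \<Rightarrow> real ^ 'm::_"
  assumes "orthogonal_transformation T"
  shows "distr sphere_measure borel T = sphere_measure"
proof (rule measure_eqI)
  note T = assms
  have lin: "linear T" and iso: "\<And>x. norm (T x) = norm x"
    using T by (auto simp: orthogonal_transformation)
  then have [measurable]: "T \<in> borel_measurable borel"
    by (simp add: borel_measurable_continuous_onI linear_continuous_on linear_conv_bounded_linear)
  have bij: "bij T"
    by (rule orthogonal_transformation_bij[OF T])
  have sgn_T: "T (sgn x) = sgn (T x)" for x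
    by (simp add: sgn_div_norm iso linear_cmul[OF lin])
  fix A assume "A \<in> sets (distr sphere_measure borel T)"
  then have A [measurable]: "A \<in> sets borel"
    by simp
  have vA [measurable]: "sgn -` A \<in> sets borel" "T -` A \<in> sets borel" "sgn -` (T -` A) \<in> sets borel"
    using measurable_sets[OF sgn_measurable_euclidean A] measurable_sets[of T borel borel A]
      measurable_sets[OF sgn_measurable_euclidean, of "T -` A"]
    by auto
  let ?U = "cball 0 1 \<inter> sgn -` (T -` A)" and ?V = "cball 0 1 \<inter> sgn -` A"
  have "bounded ?U" "bounded ?V"
    by (auto intro: bounded_subset[OF bounded_cball])
  then have fin: "emeasure lborel ?U < \<infinity>" "emeasure lborel ?V < \<infinity>"
    using emeasure_bounded_finite by blast+
  have lm: "?U \<in> lmeasurable"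
    using fin by (auto intro!: fmeasurableI simp: fmeasurable_def)
  have img: "T ` ?U = ?V"
  proof
    show "T ` ?U \<subseteq> ?V"
      by (auto simp: iso sgn_T)
    show "?V \<subseteq> T ` ?U"
    proof
      fix y assume y: "y \<in> ?V"
      obtain x where "y = T x"
        using bij by (meson bij_pointE)
      then show "y \<in> T ` ?U"
        using y by (auto simp: iso sgn_T)
    qed
  qed
  have "measure lebesgue ?U = measure lebesgue ?V"
    using measure_orthogonal_image[OF T lm] img by simp
  then have "emeasure lborel ?U = emeasure lborel ?V"
    using fin by (simp add: emeasure_eq_ennreal_measure less_top[symmetric])
  then show "emeasure (distr sphere_measure borel T) A = emeasure sphere_measure A"
    by (simp add: emeasure_distr emeasure_sphere_measure)
qed simp

section \<open>The multilinear spherical maximal function\<close>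

text \<open>The value is an extended nonnegative real, so that the supremum is a genuine supremum even
  before it is known to be finite.\<close>

definition spherical_maximal :: "('m::finite \<Rightarrow> real \<Rightarrow> complex) \<Rightarrow> real \<Rightarrow> ennreal" where
  "spherical_maximal f x =
     (SUP t\<in>{0<..}. ennreal (cmod
        (LINT y|(sphere_measure :: (real ^ 'm) measure). (\<Prod>i\<in>UNIV. f i (x - t * y $ i)))))"

section \<open>Lorentz spaces\<close>

text \<open>Everything below is stated for the modulus of a function, as a function into the extended
  nonnegative reals.\<close>

definition distribution_fun :: "'a measure \<Rightarrow> ('a \<Rightarrow> ennreal) \<Rightarrow> ennreal \<Rightarrow> ennreal" where
  "distribution_fun M g a = emeasure M {x \<in> space M. g x > a}"

definition decreasing_rearrangement :: "'a measure \<Rightarrow> ('a \<Rightarrow> ennreal) \<Rightarrow> real \<Rightarrow> ennreal" where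
  "decreasing_rearrangement M g t = Inf {a. distribution_fun M g a \<le> ennreal t}"

definition ennreal_powr :: "ennreal \<Rightarrow> real \<Rightarrow> ennreal" where
  "ennreal_powr a r = (if a = \<infinity> then \<infinity> else ennreal (enn2real a powr r))"

text \<open>The Lorentz quasinorm
  \<open>(\<integral>\<^sub>0\<^sup>\<infinity> (t\<^bsup>1/p\<^esup> g\<^sup>*(t))\<^sup>s dt/t)\<^bsup>1/s\<^esup>\<close>, with the supremum over \<open>t\<close> of
  \<open>t\<^bsup>1/p\<^esup> g\<^sup>*(t)\<close> for \<open>s = \<infinity>\<close>, meant for \<open>0 < p\<close> and \<open>0 < s\<close>. For
  \<open>p = \<infinity>\<close> it is the essential supremum whatever \<open>s\<close> is; in particular \<open>L\<^bsup>\<infinity>,1\<^esup>\<close> is read as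
  \<open>L\<^sup>\<infinity>\<close>.\<close>

definition lorentz_norm :: "'a measure \<Rightarrow> ennreal \<Rightarrow> ennreal \<Rightarrow> ('a \<Rightarrow> ennreal) \<Rightarrow> ennreal" where
  "lorentz_norm M p s g =
     (if p = \<infinity> then esssup M g
      else if s = \<infinity> then
        (SUP t\<in>{0<..}. ennreal (t powr (1 / enn2real p)) * decreasing_rearrangement M g t)
      else
        ennreal_powr
          (\<integral>\<^sup>+ t\<in>{0<..}.
             ennreal_powr (ennreal (t powr (1 / enn2real p)) * decreasing_rearrangement M g t)
               (enn2real s)
             * ennreal (1 / t) \<partial>lborel)
          (1 / enn2real s))"

section \<open>The segment of exponents\<close>

definition exponent_segment :: "'m \<Rightarrow> 'm \<Rightarrow> ('m \<Rightarrow> ennreal) set" where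
  "exponent_segment k j =
     {v. 0 \<le> v k \<and> v k \<le> 1 / 2 \<and> v j = 1 / 2 \<and> (\<forall>i. i \<noteq> k \<and> i \<noteq> j \<longrightarrow> v i = 1)}"

end

theory Submission
  imports Defs
begin

text \<open>The slices of the sphere on which all coordinates but \<open>y\<^sub>j, y\<^sub>k\<close> are fixed are circles. On the
  half of such a circle where \<open>\<bar>y\<^sub>j\<bar> \<le> \<bar>y\<^sub>k\<bar>\<close>, the average of \<open>1\<^sub>E(x - t y\<^sub>j) 1\<^sub>F(x - t y\<^sub>k)\<close> is
  bounded, up to a constant, by \<open>\<delta> M1\<^sub>E(x) + M1\<^sub>F(x) / \<delta>\<close> for every \<open>\<delta> > 0\<close>, according to whether \<open>\<bar>y\<^sub>j\<bar>\<close> is small or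
  large, where \<open>M\<close> is the Hardy--Littlewood maximal function. Optimizing in \<open>\<delta>\<close> gives
  \<open>sqrt (M1\<^sub>E(x) M1\<^sub>F(x))\<close>, whatever the radius. The remaining coordinates range
  over a ball with a bounded density, so their factors contribute ordinary averages. Hence the
  spherical maximal function is at most a constant times
  \<open>N f\<^sub>j(x) N f\<^sub>k(x)\<close> times the product of \<open>M f\<^sub>i(x)\<close> over the other \<open>i\<close>, where \<open>N f\<close> is the integral
  over \<open>l > 0\<close> of the square root of \<open>M1\<^bsub>{\<bar>f\<bar> > l}\<^esub>\<close>. Now \<open>M\<close> maps \<open>L\<^sup>1\<close> to weak \<open>L\<^sup>1\<close>; for
  \<open>2 \<le> p < \<infinity>\<close>, Kolmogorov's inequality on each layer shows that \<open>N\<close> maps \<open>L\<^bsup>p,1\<^esup>\<close> to weak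
  \<open>L\<^sup>p\<close>; and \<open>N f\<close> is at most the essential supremum of \<open>\<bar>f\<bar>\<close>. Hoelder's inequality for weak spaces
  finishes the proof.\<close>

section \<open>The Hardy--Littlewood maximal function\<close>

text \<open>Rational radii keep the supremum countable, hence measurable; this costs a factor of 2 in
  comparison with all radii.\<close>

definition hl_max :: "(real \<Rightarrow> ennreal) \<Rightarrow> real \<Rightarrow> ennreal" where
  "hl_max g x = (SUP r\<in>{r\<in>\<rat>. 0 < r}. (\<integral>\<^sup>+s\<in>{-r..r}. g (x + s) \<partial>lborel) / ennreal (2 * r))"

text \<open>The averaged function may depend on a parameter because the superlevel sets of a
  function vary with the level, and exchanging integrals later requires joint measurability in level
  and point.\<close>

lemma borel_measurable_hl_max_param [measurable]:
  assumes [measurable]: "(\<lambda>(z, y). G z y) \<in> borel_measurable (M \<Otimes>\<^sub>M borel)"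
    and [measurable]: "h \<in> borel_measurable M"
  shows "(\<lambda>z. hl_max (G z) (h z)) \<in> borel_measurable M"
proof -
  have "countable {r::real. r \<in> \<rat> \<and> 0 < r}"
    by (rule countable_subset[OF _ countable_rat]) auto
  moreover have "(\<lambda>w. G (fst w) (h (fst w) + snd w)) \<in> borel_measurable (M \<Otimes>\<^sub>M lborel)"
    using measurable_compose[OF _ assms(1), of "\<lambda>w. (fst w, h (fst w) + snd w)" "M \<Otimes>\<^sub>M lborel"]
    by simp
  then have [measurable]: "(\<lambda>(z, s). G z (h z + s)) \<in> borel_measurable (M \<Otimes>\<^sub>M lborel)"
    by (simp add: split_beta)
  have [measurable]: "(\<lambda>z. \<integral>\<^sup>+s\<in>{-r..r}. G z (h z + s) \<partial>lborel) \<in> borel_measurable M" for r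
    by measurable
  ultimately show ?thesis
    unfolding hl_max_def by (intro borel_measurable_SUP) auto
qed

lemma borel_measurable_hl_max:
  assumes "g \<in> borel_measurable borel"
  shows "hl_max g \<in> borel_measurable borel"
proof -
  have "(\<lambda>w :: real \<times> real. g (snd w)) \<in> borel_measurable (borel \<Otimes>\<^sub>M borel)"
    by (rule measurable_compose[OF measurable_snd assms])
  then have "(\<lambda>(z :: real, y). g y) \<in> borel_measurable (borel \<Otimes>\<^sub>M borel)"
    by (simp only: split_beta')
  then show ?thesis
    by (rule borel_measurable_hl_max_param[OF _ measurable_ident_sets[OF refl]])
qed

lemma ennreal_mult_divide_cancel:
  assumes "0 < c"
  shows "ennreal c * (a / ennreal c) = a"
  using assms by (simp add: ennreal_times_divide mult.commute[of "ennreal c"] ennreal_mult_divide_eq)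

text \<open>The substitution \<open>y = c * s\<close> carries the window to radius
  \<open>R = \<bar>c\<bar> * r\<close>, and its Jacobian cancels the factor
  \<open>\<bar>c\<bar>\<close> of \<open>R\<close>. The bound does not depend on \<open>c\<close>,
  which makes all later estimates uniform in the dilation \<open>t\<close>.\<close>

lemma nn_integral_le_hl_max:
  assumes [measurable]: "g \<in> borel_measurable borel" and "c \<noteq> 0" "0 \<le> r"
  shows "(\<integral>\<^sup>+s\<in>{-r..r}. g (x + c * s) \<partial>lborel) \<le> ennreal (4 * r) * hl_max g x"
proof (cases "r = 0")
  case True
  have "AE s in lborel. g (x + c * s) * indicator {-r..r} s = 0"
    using AE_lborel_singleton[of "0::real"] by eventually_elim (simp add: True)
  then have "(\<integral>\<^sup>+s\<in>{-r..r}. g (x + c * s) \<partial>lborel) = 0"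
    by (subst nn_integral_0_iff_AE) auto
  then show ?thesis by simp
next
  case False
  with assms have r: "0 < r" by simp
  define R where "R = \<bar>c\<bar> * r"
  have R: "0 < R" using r assms by (simp add: R_def)
  \<comment> \<open>Enlarging the window to a rational radius below \<open>2 * R\<close> costs the
    factor 2 that turns \<open>2 * r\<close> into \<open>4 * r\<close>.\<close>
  obtain r' where r': "r' \<in> \<rat>" "R < r'" "r' < 2 * R"
    using Rats_dense_in_real[of R "2 * R"] R by auto
  have ind: "indicator {-R..R} (0 + c * s) = (indicator {-r..r} s :: ennreal)" for s
  proof -
    have "\<bar>c * s\<bar> \<le> R \<longleftrightarrow> \<bar>s\<bar> \<le> r"
      using assms(2) by (simp add: R_def abs_mult)
    then show ?thesis
      by (simp add: indicator_def abs_le_iff minus_le_iff conj_commute)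
  qed
  have "ennreal \<bar>c\<bar> * (\<integral>\<^sup>+s\<in>{-r..r}. g (x + c * s) \<partial>lborel)
      = (\<integral>\<^sup>+y\<in>{-R..R}. g (x + y) \<partial>lborel)"
    using nn_integral_real_affine[of "\<lambda>y. g (x + y) * indicator {-R..R} y" c 0] assms(2)
    unfolding ind by simp
  also have "\<dots> \<le> (\<integral>\<^sup>+y\<in>{-r'..r'}. g (x + y) \<partial>lborel)"
    using r' by (intro nn_integral_mono) (auto split: split_indicator)
  also have "\<dots> = ennreal (2 * r') * ((\<integral>\<^sup>+y\<in>{-r'..r'}. g (x + y) \<partial>lborel) / ennreal (2 * r'))"
    using r' R by (simp add: ennreal_mult_divide_cancel)
  also have "\<dots> \<le> ennreal (2 * r') * hl_max g x"
    unfolding hl_max_def using r' R by (intro mult_left_mono SUP_upper) auto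
  also have "\<dots> \<le> ennreal (\<bar>c\<bar> * (4 * r)) * hl_max g x"
    using r' by (intro mult_right_mono ennreal_leI) (auto simp: R_def mult_ac)
  also have "\<dots> = ennreal \<bar>c\<bar> * (ennreal (4 * r) * hl_max g x)"
    using r by (simp add: ennreal_mult mult.assoc)
  finally show ?thesis
    using assms(2) by (simp add: ennreal_mult_le_mult_iff)
qed

text \<open>Averages of values at most 1; as a consequence \<open>enn2real\<close> loses nothing on
  maximal functions of indicators.\<close>

lemma hl_max_indicator_le_1:
  "hl_max (indicator E) x \<le> 1"
  unfolding hl_max_def
proof (rule SUP_least, clarsimp)
  fix r :: real assume r: "0 < r"
  have "(\<integral>\<^sup>+ s. indicator E (x + s) * indicator {- r..r} s \<partial>lborel) \<le> (\<integral>\<^sup>+ s. indicator {- r..r} s \<partial>lborel)"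
    by (intro nn_integral_mono) (auto split: split_indicator)
  also have "\<dots> = ennreal (2 * r)" using r by simp
  finally show "(\<integral>\<^sup>+ s. indicator E (x + s) * indicator {- r..r} s \<partial>lborel) / ennreal (2 * r) \<le> 1"
    using divide_right_mono_ennreal[of _ "ennreal (2 * r)" "ennreal (2 * r)"] r
    by (simp add: divide_ennreal)
qed

text \<open>Integrate the pointwise bound of the indicator of the union by the sum of the
  indicators, and swap with the counting measure. The Vitali lemma supplies a countable set of
  centres and not a sequence, hence this kind of index set.\<close>

lemma emeasure_UN_countable_le:
  assumes sets [measurable]: "\<And>i. i \<in> I \<Longrightarrow> X i \<in> sets M" and I: "countable I"
  shows "emeasure M (\<Union>i\<in>I. X i) \<le> (\<integral>\<^sup>+i. emeasure M (X i) \<partial>count_space I)"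
proof -
  have le: "indicator (\<Union>i\<in>I. X i) x \<le> (\<integral>\<^sup>+i. indicator (X i) x \<partial>count_space I)" for x
  proof (cases "x \<in> (\<Union>i\<in>I. X i)")
    case True
    then obtain j where j: "x \<in> X j" "j \<in> I" by auto
    have "(1::ennreal) = (\<integral>\<^sup>+i. indicator {j} i \<partial>count_space I)"
      using j by simp
    also have "\<dots> \<le> (\<integral>\<^sup>+i. indicator (X i) x \<partial>count_space I)"
      using j by (intro nn_integral_mono) (auto split: split_indicator)
    finally show ?thesis using True by simp
  qed simp
  have "emeasure M (\<Union>i\<in>I. X i) = (\<integral>\<^sup>+x. indicator (\<Union>i\<in>I. X i) x \<partial>M)"
    using sets.countable_UN'[OF I, of X M] sets by (simp add: image_subset_iff)
  also have "\<dots> \<le> (\<integral>\<^sup>+x. (\<integral>\<^sup>+i. indicator (X i) x \<partial>count_space I) \<partial>M)"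
    by (intro nn_integral_mono le)
  also have "\<dots> = (\<integral>\<^sup>+i. emeasure M (X i) \<partial>count_space I)"
    by (simp add: nn_integral_count_space_nn_integral I cong: nn_integral_cong_simp)
  finally show ?thesis .
qed

text \<open>Vitali covering: every point of the superlevel set is the centre of a ball on which the
  integral of \<open>g\<close> is at least \<open>a\<close> times its length. Disjoint balls
  selected among these cover the set after fivefold enlargement, whence the constant 5.\<close>

lemma hl_max_weak_type:
  assumes [measurable]: "g \<in> borel_measurable borel" and a: "0 < a"
  shows "ennreal a * emeasure lborel {x. hl_max g x > ennreal a} \<le> 5 * (\<integral>\<^sup>+x. g x \<partial>lborel)"
proof (cases "(\<integral>\<^sup>+x. g x \<partial>lborel) = \<infinity>")
  case True
  then show ?thesis by (simp add: ennreal_mult_top)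
next
  case False
  define I where "I = enn2real (\<integral>\<^sup>+x. g x \<partial>lborel)"
  have I: "(\<integral>\<^sup>+x. g x \<partial>lborel) = ennreal I"
    using False by (simp add: I_def less_top)
  let ?S = "{x. hl_max g x > ennreal a}"
  have shift: "(\<integral>\<^sup>+s\<in>{-r..r}. g (x + s) \<partial>lborel) = (\<integral>\<^sup>+y\<in>cball x r. g y \<partial>lborel)" for x r
  proof -
    have ind: "indicator {-r..r} s = (indicator (cball x r) (x + 1 * s) :: ennreal)" for s
      by (auto simp: indicator_def dist_real_def)
    have "(\<lambda>y. g y * indicator (cball x r) y) \<in> borel_measurable borel"
      by (intro borel_measurable_times_ennreal borel_measurable_indicator) auto
    then show ?thesis
      using nn_integral_real_affine[of "\<lambda>y. g y * indicator (cball x r) y" 1 x]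
      unfolding ind by simp
  qed
  have "\<exists>r>0. ennreal (a * (2 * r)) \<le> (\<integral>\<^sup>+y\<in>cball x r. g y \<partial>lborel)" if "x \<in> ?S" for x
  proof -
    have "\<exists>r>0. ennreal a < (\<integral>\<^sup>+y\<in>cball x r. g y \<partial>lborel) / ennreal (2 * r)"
    proof -
      have "ennreal a < (SUP r\<in>{r\<in>\<rat>. 0 < r}. (\<integral>\<^sup>+y\<in>cball x r. g y \<partial>lborel) / ennreal (2 * r))"
        using that unfolding hl_max_def shift by simp
      then show ?thesis
        unfolding less_SUP_iff by blast
    qed
    then obtain r where r: "r > 0" "ennreal a < (\<integral>\<^sup>+y\<in>cball x r. g y \<partial>lborel) / ennreal (2 * r)"
      by blast
    have "ennreal (a * (2 * r)) = ennreal a * ennreal (2 * r)"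
      using a r by (simp add: ennreal_mult)
    also have "\<dots> \<le> (\<integral>\<^sup>+y\<in>cball x r. g y \<partial>lborel) / ennreal (2 * r) * ennreal (2 * r)"
      using r by (intro mult_right_mono) auto
    also have "\<dots> = (\<integral>\<^sup>+y\<in>cball x r. g y \<partial>lborel)"
      using r by (subst mult.commute) (simp add: ennreal_mult_divide_cancel)
    finally show ?thesis using r by blast
  qed
  then obtain \<rho> where \<rho>: "\<And>x. x \<in> ?S \<Longrightarrow> \<rho> x > 0"
    "\<And>x. x \<in> ?S \<Longrightarrow> ennreal (a * (2 * \<rho> x)) \<le> (\<integral>\<^sup>+y\<in>cball x (\<rho> x). g y \<partial>lborel)"
    by metis
  \<comment> \<open>Finiteness of the integral bounds the radii, as the covering lemma
    demands.\<close>
  have bound: "\<rho> x \<le> I / (2 * a)" if "x \<in> ?S" for x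
  proof -
    have "ennreal (a * (2 * \<rho> x)) \<le> (\<integral>\<^sup>+y. g y \<partial>lborel)"
      by (rule order_trans[OF \<rho>(2)[OF that] nn_integral_mono]) (auto split: split_indicator)
    then have "a * (2 * \<rho> x) \<le> I"
      unfolding I by (subst (asm) ennreal_le_iff) (auto simp: I_def)
    then show ?thesis
      using a by (simp add: field_simps)
  qed
  obtain C where C: "countable C" "C \<subseteq> ?S" "pairwise (\<lambda>i j. disjnt (cball i (\<rho> i)) (cball j (\<rho> j))) C"
    "?S \<subseteq> (\<Union>i\<in>C. cball i (5 * \<rho> i))"
  proof (rule Vitali_covering_lemma_cballs[where S = ?S and K = ?S and a = "\<lambda>x. x" and r = \<rho> and B = "I / (2 * a)"])
    show "?S \<subseteq> (\<Union>i\<in>?S. cball i (\<rho> i))"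
      using \<rho>(1) by (fastforce simp: less_imp_le)
    show "0 < \<rho> i \<and> \<rho> i \<le> I / (2 * a)" if "i \<in> ?S" for i
      using \<rho>(1) bound that by blast
  qed
  have disj: "disjoint_family_on (\<lambda>i. cball i (\<rho> i)) C"
    using C(3) by (auto simp: disjoint_family_on_def pairwise_def disjnt_def)
  have "ennreal a * emeasure lborel ?S \<le> ennreal a * emeasure lborel (\<Union>i\<in>C. cball i (5 * \<rho> i))"
    using C by (intro mult_left_mono emeasure_mono sets.countable_UN') auto
  also have "\<dots> \<le> ennreal a * (\<integral>\<^sup>+i. emeasure lborel (cball i (5 * \<rho> i)) \<partial>count_space C)"
    using C by (intro mult_left_mono emeasure_UN_countable_le) auto
  also have "\<dots> = (\<integral>\<^sup>+i. ennreal a * emeasure lborel (cball i (5 * \<rho> i)) \<partial>count_space C)"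
    by (rule nn_integral_cmult[symmetric]) simp
  also have "\<dots> \<le> (\<integral>\<^sup>+i. 5 * (\<integral>\<^sup>+y\<in>cball i (\<rho> i). g y \<partial>lborel) \<partial>count_space C)"
  proof (rule nn_integral_mono)
    fix i assume "i \<in> space (count_space C)"
    then have i: "i \<in> ?S" using C by auto
    have "ennreal a * emeasure lborel (cball i (5 * \<rho> i)) = ennreal a * ennreal (10 * \<rho> i)"
      using \<rho>(1)[OF i] by (simp add: cball_eq_atLeastAtMost)
    also have "\<dots> = 5 * ennreal (a * (2 * \<rho> i))"
      using a \<rho>(1)[OF i] by (simp add: ennreal_mult[symmetric] ennreal_numeral[symmetric] mult_ac del: ennreal_numeral)
    also have "\<dots> \<le> 5 * (\<integral>\<^sup>+y\<in>cball i (\<rho> i). g y \<partial>lborel)"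
      by (intro mult_left_mono \<rho>(2) i) auto
    finally show "ennreal a * emeasure lborel (cball i (5 * \<rho> i)) \<le> 5 * (\<integral>\<^sup>+y\<in>cball i (\<rho> i). g y \<partial>lborel)" .
  qed
  \<comment> \<open>The integrals over the balls are values of the measure with density
    \<open>g\<close>; disjointness makes them add up to at most its total mass.\<close>
  also have "\<dots> = 5 * (\<integral>\<^sup>+i. emeasure (density lborel g) (cball i (\<rho> i)) \<partial>count_space C)"
    by (subst nn_integral_cmult) (auto simp: emeasure_density)
  also have "\<dots> = 5 * emeasure (density lborel g) (\<Union>i\<in>C. cball i (\<rho> i))"
    using C disj by (subst emeasure_UN_countable) auto
  also have "\<dots> \<le> 5 * emeasure (density lborel g) (space (density lborel g))"
    by (intro mult_left_mono emeasure_space) auto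
  also have "\<dots> = 5 * (\<integral>\<^sup>+x. g x \<partial>lborel)"
    by (simp add: emeasure_density)
  finally show ?thesis .
qed

section \<open>The bilinear estimate on a circle\<close>

definition sqrt_hl_max :: "real set \<Rightarrow> real \<Rightarrow> ennreal" where
  "sqrt_hl_max E x = ennreal (sqrt (enn2real (hl_max (indicator E) x)))"

text \<open>For \<open>g = 1\<^sub>E\<close> this is the square root of the maximal function of \<open>1\<^sub>E\<close>.
  The layers of \<open>g\<close> are added up because the square root itself is not sublinear.\<close>

definition hl_root :: "(real \<Rightarrow> ennreal) \<Rightarrow> real \<Rightarrow> ennreal" where
  "hl_root g x = (\<integral>\<^sup>+l\<in>{0..}. sqrt_hl_max {y. ennreal l < g y} x \<partial>lborel)"

lemma borel_measurable_sqrt_hl_max_param [measurable]: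
  assumes "(\<lambda>(z, y). indicator (E z) y :: ennreal) \<in> borel_measurable (M \<Otimes>\<^sub>M borel)"
    and [measurable]: "h \<in> borel_measurable M"
  shows "(\<lambda>z. sqrt_hl_max (E z) (h z)) \<in> borel_measurable M"
proof -
  note [measurable] = borel_measurable_hl_max_param[OF assms]
  show ?thesis
    unfolding sqrt_hl_max_def by measurable
qed

lemma borel_measurable_superlevel [measurable]:
  assumes [measurable]: "g \<in> borel_measurable borel"
  shows "(\<lambda>(z, y). indicator {y. ennreal z < g y} y :: ennreal) \<in> borel_measurable (borel \<Otimes>\<^sub>M borel)"
  unfolding indicator_def mem_Collect_eq by measurable

text \<open>Layer-cake formula at a point: the contributing levels fill \<open>{0..<g y}\<close>, or
  the whole half-line when \<open>g y\<close> is infinite.\<close>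

lemma nn_integral_superlevel:
  "(\<integral>\<^sup>+l\<in>{0..}. indicator {y. ennreal l < g y} y \<partial>lborel) = g y"
proof (cases "g y" rule: ennreal_cases)
  case (real r)
  have "(\<integral>\<^sup>+l\<in>{0..}. indicator {y. ennreal l < g y} y \<partial>lborel) = (\<integral>\<^sup>+l. indicator {0..<r} l \<partial>lborel)"
    using real by (intro nn_integral_cong) (auto split: split_indicator simp: ennreal_less_iff)
  then show ?thesis using real by simp
next
  case top
  have "(\<integral>\<^sup>+l\<in>{0..}. indicator {y. ennreal l < g y} y \<partial>lborel) = (\<integral>\<^sup>+l. indicator {0::real..} l \<partial>lborel)"
    using top by (intro nn_integral_cong) (auto split: split_indicator)
  also have "\<dots> = \<infinity>"
  proof -
    have "ennreal n \<le> emeasure lborel {0::real..}" if "0 \<le> n" for n :: real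
      using that emeasure_mono[of "{0..n}" "{0..}" lborel] by simp
    then have "of_nat n \<le> emeasure lborel {0::real..}" for n :: nat
      by (metis ennreal_of_nat_eq_real_of_nat of_nat_0_le_iff)
    then show ?thesis
      by (metis (no_types, lifting) ennreal_Ex_less_of_nat infinity_ennreal_def leD linorder_not_le
          nn_integral_indicator sets_lborel atLeast_borel less_top)
  qed
  finally show ?thesis using top by simp
qed

text \<open>Drop \<open>1\<^sub>F\<close> for \<open>\<bar>s\<bar> \<le> \<delta>\<rho>\<close>; elsewhere drop \<open>1\<^sub>E\<close> and substitute
  \<open>u = - sqrt (\<rho>\<^sup>2 - s\<^sup>2)\<close>, whose derivative is at least \<open>\<delta>\<close> there.\<close>

lemma circle_arc_indicator_le:
  assumes [measurable]: "E \<in> sets borel" "F \<in> sets borel"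
    and nz: "\<tau> \<noteq> 0" "\<tau>' \<noteq> 0" and "0 < \<rho>" and \<delta>: "0 < \<delta>"
  shows "(\<integral>\<^sup>+s. indicator E (x + \<tau> * s) * indicator F (x + \<tau>' * sqrt (\<rho>\<^sup>2 - s\<^sup>2)) * indicator {s. 2 * s\<^sup>2 \<le> \<rho>\<^sup>2} s \<partial>lborel)
    \<le> ennreal (4 * \<rho> * \<delta>) * hl_max (indicator E) x + ennreal (8 * \<rho> / \<delta>) * hl_max (indicator F) x"
proof -
  \<comment> \<open>\<open>b\<close> is the largest \<open>\<bar>s\<bar>\<close> on the part of the
    circle where \<open>s\<close> is the smaller coordinate in modulus.\<close>
  define b where "b = \<rho> / sqrt 2"
  have b: "0 < b" "b < \<rho>" "b\<^sup>2 * 2 = \<rho>\<^sup>2"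
    using \<open>0 < \<rho>\<close> by (auto simp: b_def power_divide divide_less_eq)
  have b_iff: "2 * s\<^sup>2 \<le> \<rho>\<^sup>2 \<longleftrightarrow> \<bar>s\<bar> \<le> b" for s
    using b abs_le_square_iff[of s b] by auto
  let ?a = "\<delta> * \<rho>"
  let ?F = "\<lambda>s. indicator F (x + \<tau>' * sqrt (\<rho>\<^sup>2 - s\<^sup>2)) :: ennreal"
  have far: "(\<integral>\<^sup>+s\<in>{?a..b}. ?F s \<partial>lborel) \<le> ennreal (4 * \<rho> / \<delta>) * hl_max (indicator F) x"
  proof (cases "?a < b")
    case True
    \<comment> \<open>The minus sign makes \<open>?g\<close> increasing on \<open>{?a..b}\<close>,
      as the substitution rule requires; it is compensated by \<open>- \<tau>'\<close>
      below.\<close>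
    let ?g = "\<lambda>s. - sqrt (\<rho>\<^sup>2 - s\<^sup>2)" and ?g' = "\<lambda>s. s / sqrt (\<rho>\<^sup>2 - s\<^sup>2)"
    have pos: "0 < s" "s < \<rho>" "0 < \<rho>\<^sup>2 - s\<^sup>2" if "s \<in> {?a..b}" for s
    proof -
      show "0 < s" using that \<delta> \<open>0 < \<rho>\<close> by (auto intro: less_le_trans[of _ "?a"])
      moreover show "s < \<rho>" using that b by auto
      ultimately show "0 < \<rho>\<^sup>2 - s\<^sup>2" by (simp add: power_strict_mono)
    qed
    have ge: "\<delta> \<le> ?g' s" if "s \<in> {?a..b}" for s
    proof -
      have "sqrt (\<rho>\<^sup>2 - s\<^sup>2) \<le> \<rho>"
        using \<open>0 < \<rho>\<close> by (intro real_le_lsqrt) auto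
      then have "\<delta> * sqrt (\<rho>\<^sup>2 - s\<^sup>2) \<le> s"
        using that \<delta> by (auto intro: order_trans[of _ ?a])
      then show ?thesis using pos[OF that] by (simp add: le_divide_eq)
    qed
    have "ennreal \<delta> * (\<integral>\<^sup>+s\<in>{?a..b}. ?F s \<partial>lborel) = (\<integral>\<^sup>+s. ennreal \<delta> * (?F s * indicator {?a..b} s) \<partial>lborel)"
      by (subst nn_integral_cmult) auto
    also have "\<dots> \<le> (\<integral>\<^sup>+s. indicator F (x + (- \<tau>') * ?g s) * ennreal (?g' s) * indicator {?a..b} s \<partial>lborel)"
      using ge by (intro nn_integral_mono) (auto split: split_indicator intro!: ennreal_leI)
    also have "\<dots> = (\<integral>\<^sup>+u. indicator F (x + (- \<tau>') * u) * indicator {?g ?a..?g b} u \<partial>lborel)"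
    proof (rule nn_integral_substitution_aux[symmetric])
      show "(?g has_real_derivative ?g' s) (at s)" if "s \<in> {?a..b}" for s
        using pos[OF that] by (auto intro!: derivative_eq_intros simp: field_simps)
      show "continuous_on {?a..b} ?g'"
        using pos by (intro continuous_intros) (metis less_irrefl real_sqrt_gt_zero)
      show "0 \<le> ?g' s" if "s \<in> {?a..b}" for s
        using ge[OF that] \<delta> by simp
    qed (use True in auto)
    also have "\<dots> \<le> (\<integral>\<^sup>+u\<in>{-\<rho>..\<rho>}. indicator F (x + (- \<tau>') * u) \<partial>lborel)"
    proof (intro nn_integral_mono mult_left_mono)
      have "- \<rho> \<le> ?g ?a"
        using \<open>0 < \<rho>\<close> by (simp, intro real_le_lsqrt) auto
      moreover have "?g b \<le> \<rho>"
        using \<open>0 < \<rho>\<close> pos(3)[of b] True real_sqrt_gt_zero[of "\<rho>\<^sup>2 - b\<^sup>2"]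
        by (metis atLeastAtMost_iff less_eq_real_def neg_le_0_iff_le order_trans)
      ultimately show "indicator {?g ?a..?g b} u \<le> (indicator {-\<rho>..\<rho>} u :: ennreal)" for u
        by (auto split: split_indicator)
    qed auto
    also have "\<dots> \<le> ennreal (4 * \<rho>) * hl_max (indicator F) x"
      using nz \<open>0 < \<rho>\<close> by (intro nn_integral_le_hl_max) auto
    also have "\<dots> = ennreal \<delta> * (ennreal (4 * \<rho> / \<delta>) * hl_max (indicator F) x)"
      using \<delta> \<open>0 < \<rho>\<close> by (simp add: mult.assoc[symmetric] ennreal_mult[symmetric])
    finally show ?thesis
      using \<delta> by (simp add: ennreal_mult_le_mult_iff)
  next
    case False
    have "AE s in lborel. ?F s * indicator {?a..b} s = 0"
      using AE_lborel_singleton[of b] by eventually_elim (use False in auto)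
    then have "(\<integral>\<^sup>+s\<in>{?a..b}. ?F s \<partial>lborel) = 0"
      by (subst nn_integral_0_iff_AE) auto
    then show ?thesis by simp
  qed
  \<comment> \<open>\<open>?F\<close> is even in \<open>s\<close>, so the left arc contributes as
    much as the right one; this doubles the 4 to 8.\<close>
  have far': "(\<integral>\<^sup>+s\<in>{-b..-?a}. ?F s \<partial>lborel) = (\<integral>\<^sup>+s\<in>{?a..b}. ?F s \<partial>lborel)"
    using nn_integral_real_affine[of "\<lambda>s. ?F s * indicator {-b..-?a} s" "-1" 0]
    by (simp add: indicator_def minus_le_iff le_minus_iff conj_commute del: indicator_simps)
  have near: "(\<integral>\<^sup>+s\<in>{-?a..?a}. indicator E (x + \<tau> * s) \<partial>lborel) \<le> ennreal (4 * ?a) * hl_max (indicator E) x"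
    using nz \<delta> \<open>0 < \<rho>\<close> by (intro nn_integral_le_hl_max) auto
  have "(\<integral>\<^sup>+s. indicator E (x + \<tau> * s) * ?F s * indicator {s. 2 * s\<^sup>2 \<le> \<rho>\<^sup>2} s \<partial>lborel)
    \<le> (\<integral>\<^sup>+s. indicator E (x + \<tau> * s) * indicator {-?a..?a} s
         + (?F s * indicator {?a..b} s + ?F s * indicator {-b..-?a} s) \<partial>lborel)"
    by (intro nn_integral_mono) (auto simp: b_iff split: split_indicator)
  also have "\<dots> = (\<integral>\<^sup>+s\<in>{-?a..?a}. indicator E (x + \<tau> * s) \<partial>lborel)
      + ((\<integral>\<^sup>+s\<in>{?a..b}. ?F s \<partial>lborel) + (\<integral>\<^sup>+s\<in>{-b..-?a}. ?F s \<partial>lborel))"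
    by (subst nn_integral_add, simp, simp, subst nn_integral_add, simp_all)
  also have "\<dots> \<le> ennreal (4 * ?a) * hl_max (indicator E) x
      + (ennreal (4 * \<rho> / \<delta>) * hl_max (indicator F) x + ennreal (4 * \<rho> / \<delta>) * hl_max (indicator F) x)"
    unfolding far' by (intro add_mono near far)
  also have "\<dots> = ennreal (4 * \<rho> * \<delta>) * hl_max (indicator E) x + ennreal (8 * \<rho> / \<delta>) * hl_max (indicator F) x"
  proof -
    have "ennreal (8 * \<rho> / \<delta>) = ennreal (4 * \<rho> / \<delta>) + ennreal (4 * \<rho> / \<delta>)"
      using \<delta> \<open>0 < \<rho>\<close> by (subst ennreal_plus[symmetric]) auto
    then show ?thesis by (simp add: distrib_left mult_ac)
  qed
  finally show ?thesis .
qed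

text \<open>Balance the two terms of the arc estimate:
  \<open>\<delta> = sqrt \<beta> / sqrt \<alpha>\<close> makes them 4 and 8 times
  \<open>\<rho> * sqrt \<alpha> * sqrt \<beta>\<close>, in total 12.\<close>

lemma circle_indicator_le:
  assumes [measurable]: "E \<in> sets borel" "F \<in> sets borel"
    and nz: "\<tau> \<noteq> 0" "\<tau>' \<noteq> 0" and \<rho>: "0 < \<rho>"
  shows "(\<integral>\<^sup>+s. indicator E (x + \<tau> * s) * indicator F (x + \<tau>' * sqrt (\<rho>\<^sup>2 - s\<^sup>2)) * indicator {s. 2 * s\<^sup>2 \<le> \<rho>\<^sup>2} s \<partial>lborel)
    \<le> ennreal (12 * \<rho>) * (sqrt_hl_max E x * sqrt_hl_max F x)" (is "?I \<le> _")
proof -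
  define \<alpha> where "\<alpha> = enn2real (hl_max (indicator E) x)"
  define \<beta> where "\<beta> = enn2real (hl_max (indicator F) x)"
  have \<alpha>: "hl_max (indicator E) x = ennreal \<alpha>" "0 \<le> \<alpha>" and \<beta>: "hl_max (indicator F) x = ennreal \<beta>" "0 \<le> \<beta>"
    unfolding \<alpha>_def \<beta>_def
    using hl_max_indicator_le_1[of E x] hl_max_indicator_le_1[of F x] ennreal_one_less_top
    by (auto simp del: ennreal_one_less_top intro: le_less_trans)
  have bound: "?I \<le> ennreal (4 * \<rho> * \<delta> * \<alpha> + 8 * \<rho> / \<delta> * \<beta>)" if "0 < \<delta>" for \<delta>
    using circle_arc_indicator_le[OF assms(1,2) nz \<rho> that, of x] that \<rho> \<alpha> \<beta>
    by (simp add: ennreal_mult[symmetric] ennreal_plus[symmetric] del: ennreal_plus)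
  have "?I \<le> ennreal (12 * \<rho> * (sqrt \<alpha> * sqrt \<beta>))"
  proof (cases "\<alpha> = 0 \<or> \<beta> = 0")
    case False
    then have pos: "0 < \<alpha>" "0 < \<beta>" using \<alpha> \<beta> by auto
    let ?a = "sqrt \<alpha>" and ?b = "sqrt \<beta>"
    have ab: "\<alpha> = ?a * ?a" "\<beta> = ?b * ?b" "0 < ?a" "0 < ?b" using pos by auto
    have "4 * \<rho> * (b / a) * (a * a) + 8 * \<rho> / (b / a) * (b * b) = 12 * \<rho> * (a * b)"
      if "0 < a" "0 < b" for a b
      using that by (simp add: field_simps)
    from this[OF ab(3,4)]
    have eq: "4 * \<rho> * (?b / ?a) * \<alpha> + 8 * \<rho> / (?b / ?a) * \<beta> = 12 * \<rho> * (?a * ?b)"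
      by (simp only: ab(1,2)[symmetric])
    show ?thesis
      using bound[of "?b / ?a", unfolded eq] ab(3,4) by (simp del: real_sqrt_gt_0_iff)
  next
    case True
    \<comment> \<open>With \<open>\<beta> = 0\<close> let \<open>\<delta>\<close> tend to 0, with
      \<open>\<alpha> = 0 < \<beta>\<close> let it tend to infinity; the explicit choices bring the
      bound below \<open>e\<close>. The 1 in the denominator covers the case where both
      vanish.\<close>
    have "?I \<le> 0 + ennreal e" if e: "0 < e" for e
    proof (cases "\<beta> = 0")
      case True
      have pos: "0 < 4 * \<rho> * \<alpha> + 1"
        using \<rho> \<alpha>(2) by (simp add: add_nonneg_pos)
      then have "4 * \<rho> * (e / (4 * \<rho> * \<alpha> + 1)) * \<alpha> \<le> e"
        using e by (simp add: divide_le_eq algebra_simps)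
      then have "ennreal (4 * \<rho> * (e / (4 * \<rho> * \<alpha> + 1)) * \<alpha>) \<le> ennreal e"
        by (rule ennreal_leI)
      moreover have "0 < e / (4 * \<rho> * \<alpha> + 1)"
        using e pos by simp
      ultimately show ?thesis
        using bound[of "e / (4 * \<rho> * \<alpha> + 1)"] True by (auto intro: order_trans)
    next
      case False
      with True \<beta> have "\<alpha> = 0" "0 < \<beta>" by auto
      then show ?thesis
        using bound[of "8 * \<rho> * \<beta> / e"] e \<rho> by (simp add: field_simps)
    qed
    then have "?I \<le> 0"
      by (rule ennreal_le_epsilon)
    then show ?thesis by simp
  qed
  also have "\<dots> = ennreal (12 * \<rho>) * (sqrt_hl_max E x * sqrt_hl_max F x)"
    using \<rho> \<alpha>(2) \<beta>(2) by (simp add: sqrt_hl_max_def ennreal_mult \<alpha>_def \<beta>_def)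
  finally show ?thesis .
qed

text \<open>Write \<open>a\<close> and \<open>b\<close> as integrals over their superlevel
  indicators, move both level integrals outside by Tonelli, and apply the estimate for sets to each
  pair of levels. That bound is a product in the two levels, so the double integral factors.\<close>

lemma circle_le:
  assumes [measurable]: "a \<in> borel_measurable borel" "b \<in> borel_measurable borel"
    and nz: "\<tau> \<noteq> 0" "\<tau>' \<noteq> 0" and \<rho>: "0 < \<rho>"
  shows "(\<integral>\<^sup>+s. a (x + \<tau> * s) * b (x + \<tau>' * sqrt (\<rho>\<^sup>2 - s\<^sup>2)) * indicator {s. 2 * s\<^sup>2 \<le> \<rho>\<^sup>2} s \<partial>lborel)
    \<le> ennreal (12 * \<rho>) * (hl_root a x * hl_root b x)"
proof -
  let ?S = "indicator {s. 2 * s\<^sup>2 \<le> \<rho>\<^sup>2} :: real \<Rightarrow> ennreal"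
  let ?A = "\<lambda>l. {y. ennreal l < a y}" and ?B = "\<lambda>l. {y. ennreal l < b y}"
  let ?y = "\<lambda>s. x + \<tau> * s" and ?z = "\<lambda>s. x + \<tau>' * sqrt (\<rho>\<^sup>2 - s\<^sup>2)"
  have [measurable]: "(\<lambda>(l, s). indicator (?A l) (?y s) :: ennreal) \<in> borel_measurable (lborel \<Otimes>\<^sub>M lborel)"
    "(\<lambda>(l, s). indicator (?B l) (?z s) :: ennreal) \<in> borel_measurable (lborel \<Otimes>\<^sub>M lborel)"
    "?S \<in> borel_measurable lborel"
    unfolding indicator_def mem_Collect_eq by measurable
  have [measurable]: "(\<lambda>l. sqrt_hl_max (?A l) x) \<in> borel_measurable lborel"
    "(\<lambda>l. sqrt_hl_max (?B l) x) \<in> borel_measurable lborel"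
    by (auto simp: measurable_lborel1 intro!: borel_measurable_sqrt_hl_max_param borel_measurable_superlevel)
  have [measurable]: "(\<lambda>l. indicator (?A l) y :: ennreal) \<in> borel_measurable lborel"
    "(\<lambda>l. indicator (?B l) y :: ennreal) \<in> borel_measurable lborel" for y
    unfolding indicator_def mem_Collect_eq by measurable
  have [measurable]: "(\<lambda>s. indicator (?A l) (?y s) :: ennreal) \<in> borel_measurable lborel"
    "(\<lambda>s. indicator (?B l) (?z s) :: ennreal) \<in> borel_measurable lborel" for l
    unfolding indicator_def mem_Collect_eq by measurable
  \<comment> \<open>\<open>c\<close> stands for the rest of the integrand, which is carried along
    while one factor is expanded.\<close>
  have layer: "a y * c = (\<integral>\<^sup>+l. indicator (?A l) y * indicator {0..} l * c \<partial>lborel)"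
    "b y * c = (\<integral>\<^sup>+l. indicator (?B l) y * indicator {0..} l * c \<partial>lborel)" for y c
    by (subst nn_integral_multc; simp add: nn_integral_superlevel)+
  \<comment> \<open>Only \<open>b\<close> is decomposed here; a single layer stands in for
    \<open>a\<close>.\<close>
  have set_step: "(\<integral>\<^sup>+s. indicator (?A l) (?y s) * b (?z s) * ?S s \<partial>lborel)
    \<le> ennreal (12 * \<rho>) * (sqrt_hl_max (?A l) x * hl_root b x)" for l
  proof -
    have "(\<integral>\<^sup>+s. indicator (?A l) (?y s) * b (?z s) * ?S s \<partial>lborel)
      = (\<integral>\<^sup>+s. (\<integral>\<^sup>+m. indicator (?B m) (?z s) * indicator {0..} m * (indicator (?A l) (?y s) * ?S s) \<partial>lborel) \<partial>lborel)"
      by (intro nn_integral_cong, subst layer(2)[symmetric]) (simp only: mult_ac)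
    also have "\<dots> = (\<integral>\<^sup>+m. (\<integral>\<^sup>+s. indicator {0..} m * (indicator (?A l) (?y s) * indicator (?B m) (?z s) * ?S s) \<partial>lborel) \<partial>lborel)"
      by (subst lborel_pair.Fubini') (measurable, simp only: mult_ac)
    also have "\<dots> \<le> (\<integral>\<^sup>+m. ennreal (12 * \<rho>) * sqrt_hl_max (?A l) x * (sqrt_hl_max (?B m) x * indicator {0..} m) \<partial>lborel)"
    proof (rule nn_integral_mono)
      fix m
      have "(\<integral>\<^sup>+s. indicator {0..} m * (indicator (?A l) (?y s) * indicator (?B m) (?z s) * ?S s) \<partial>lborel)
        = indicator {0..} m * (\<integral>\<^sup>+s. indicator (?A l) (?y s) * indicator (?B m) (?z s) * ?S s \<partial>lborel)"
        by (rule nn_integral_cmult) measurable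
      also have "\<dots> \<le> indicator {0..} m * (ennreal (12 * \<rho>) * (sqrt_hl_max (?A l) x * sqrt_hl_max (?B m) x))"
        by (intro mult_left_mono circle_indicator_le nz \<rho>) auto
      finally show "(\<integral>\<^sup>+s. indicator {0..} m * (indicator (?A l) (?y s) * indicator (?B m) (?z s) * ?S s) \<partial>lborel)
        \<le> ennreal (12 * \<rho>) * sqrt_hl_max (?A l) x * (sqrt_hl_max (?B m) x * indicator {0..} m)"
        by (simp add: mult_ac)
    qed
    also have "\<dots> = ennreal (12 * \<rho>) * (sqrt_hl_max (?A l) x * hl_root b x)"
      by (subst nn_integral_cmult) (auto simp: hl_root_def mult_ac)
    finally show ?thesis .
  qed
  have "(\<integral>\<^sup>+s. a (?y s) * b (?z s) * ?S s \<partial>lborel)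
    = (\<integral>\<^sup>+s. (\<integral>\<^sup>+l. indicator (?A l) (?y s) * indicator {0..} l * (b (?z s) * ?S s) \<partial>lborel) \<partial>lborel)"
    by (intro nn_integral_cong, subst layer(1)[symmetric]) (simp only: mult_ac)
  also have "\<dots> = (\<integral>\<^sup>+l. (\<integral>\<^sup>+s. indicator {0..} l * (indicator (?A l) (?y s) * b (?z s) * ?S s) \<partial>lborel) \<partial>lborel)"
    by (subst lborel_pair.Fubini') (measurable, simp only: mult_ac)
  also have "\<dots> \<le> (\<integral>\<^sup>+l. ennreal (12 * \<rho>) * hl_root b x * (sqrt_hl_max (?A l) x * indicator {0..} l) \<partial>lborel)"
  proof (rule nn_integral_mono)
    fix l
    have "(\<integral>\<^sup>+s. indicator {0..} l * (indicator (?A l) (?y s) * b (?z s) * ?S s) \<partial>lborel)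
      = indicator {0..} l * (\<integral>\<^sup>+s. indicator (?A l) (?y s) * b (?z s) * ?S s \<partial>lborel)"
      by (rule nn_integral_cmult) measurable
    also have "\<dots> \<le> indicator {0..} l * (ennreal (12 * \<rho>) * (sqrt_hl_max (?A l) x * hl_root b x))"
      by (intro mult_left_mono set_step) auto
    finally show "(\<integral>\<^sup>+s. indicator {0..} l * (indicator (?A l) (?y s) * b (?z s) * ?S s) \<partial>lborel)
      \<le> ennreal (12 * \<rho>) * hl_root b x * (sqrt_hl_max (?A l) x * indicator {0..} l)"
      by (simp add: mult_ac)
  qed
  also have "\<dots> = ennreal (12 * \<rho>) * (hl_root a x * hl_root b x)"
    by (subst nn_integral_cmult) (auto simp: hl_root_def mult_ac)
  finally show ?thesis .
qed

section \<open>Slicing the ball\<close>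

text \<open>The substitution is \<open>q = A + u\<^sup>2 + v\<^sup>2\<close>; the condition \<open>\<bar>u\<bar> \<le> v\<close> keeps the Jacobian
  \<open>1 / (2 v)\<close> below \<open>1 / sqrt (q - A)\<close>.\<close>

lemma nn_integral_sphere_coordinate_le:
  fixes A u \<tau> \<tau>' x :: real
  assumes [measurable]: "P \<in> borel_measurable borel" "a \<in> borel_measurable borel" "b \<in> borel_measurable borel"
    and A: "0 \<le> A"
  shows "(\<integral>\<^sup>+v. (if A + u\<^sup>2 + v\<^sup>2 \<le> 1 \<and> \<bar>u\<bar> \<le> v
      then P (A + u\<^sup>2 + v\<^sup>2) * a (x + \<tau> / sqrt (A + u\<^sup>2 + v\<^sup>2) * u) * b (x + \<tau>' / sqrt (A + u\<^sup>2 + v\<^sup>2) * v) else 0) \<partial>lborel)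
    \<le> (\<integral>\<^sup>+q. (if 2 * u\<^sup>2 \<le> q - A \<and> q \<le> 1
      then P q * ennreal (1 / sqrt (q - A)) * (a (x + \<tau> / sqrt q * u) * b (x + \<tau>' / sqrt q * sqrt (q - A - u\<^sup>2))) else 0) \<partial>lborel)"
    (is "?L \<le> ?R")
proof (cases "\<bar>u\<bar> < 1")
  case False
  then have u: "1 \<le> u\<^sup>2"
    using abs_le_square_iff[of 1 u] by simp
  have no: "\<not> (A + u\<^sup>2 + v\<^sup>2 \<le> 1 \<and> \<bar>u\<bar> \<le> v)" for v
  proof
    assume v: "A + u\<^sup>2 + v\<^sup>2 \<le> 1 \<and> \<bar>u\<bar> \<le> v"
    then have "0 < v\<^sup>2" using False by simp
    then show False using v A u by linarith
  qed
  show ?thesis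
    unfolding if_not_P[OF no] by simp
next
  case True
  let ?g = "\<lambda>v. A + u\<^sup>2 + v\<^sup>2"
  \<comment> \<open>\<open>f\<close> is the integrand in the variable \<open>q\<close>; its last
    factor is \<open>1 / (2 * v)\<close>, the inverse of the derivative of
    \<open>?g\<close>.\<close>
  define f where "f q = (if q \<le> 1 then P q * (a (x + \<tau> / sqrt q * u) * b (x + \<tau>' / sqrt q * sqrt (q - A - u\<^sup>2)))
      * ennreal (1 / (2 * sqrt (q - A - u\<^sup>2))) else 0)" for q
  have [measurable]: "f \<in> borel_measurable borel"
    unfolding f_def by measurable
  \<comment> \<open>The point \<open>v = 0\<close> is discarded: there \<open>1 / (2 * v)\<close> is
    0 by convention and does not cancel the derivative.\<close>
  have "?L \<le> (\<integral>\<^sup>+v. f (?g v) * ennreal (2 * v) * indicator {\<bar>u\<bar>..1} v \<partial>lborel)"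
  proof (rule nn_integral_mono_AE)
    show "AE v in lborel. (if A + u\<^sup>2 + v\<^sup>2 \<le> 1 \<and> \<bar>u\<bar> \<le> v
      then P (A + u\<^sup>2 + v\<^sup>2) * a (x + \<tau> / sqrt (A + u\<^sup>2 + v\<^sup>2) * u) * b (x + \<tau>' / sqrt (A + u\<^sup>2 + v\<^sup>2) * v) else 0)
      \<le> f (?g v) * ennreal (2 * v) * indicator {\<bar>u\<bar>..1} v"
      using AE_lborel_singleton[of "0::real"]
    proof eventually_elim
      case (elim v)
      show ?case
      proof (cases "A + u\<^sup>2 + v\<^sup>2 \<le> 1 \<and> \<bar>u\<bar> \<le> v")
        case True
        then have v: "0 < v" using elim by auto
        have "v\<^sup>2 \<le> 1" using True A by (smt (verit) zero_le_power2)
        then have "v \<le> 1" using v abs_le_square_iff[of v 1] by simp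
        moreover have "ennreal (1 / (2 * v)) * ennreal (2 * v) = 1"
          using v by (simp add: ennreal_mult[symmetric])
        ultimately show ?thesis
          using True v by (simp add: f_def mult.assoc)
      qed auto
    qed
  qed
  also have "\<dots> = (\<integral>\<^sup>+q. f q * indicator {?g \<bar>u\<bar>..?g 1} q \<partial>lborel)"
    by (rule nn_integral_substitution_aux[symmetric])
       (use True in \<open>auto intro!: derivative_eq_intros continuous_intros\<close>)
  also have "\<dots> \<le> ?R"
  proof (rule nn_integral_mono)
    fix q
    show "f q * indicator {?g \<bar>u\<bar>..?g 1} q \<le> (if 2 * u\<^sup>2 \<le> q - A \<and> q \<le> 1
      then P q * ennreal (1 / sqrt (q - A)) * (a (x + \<tau> / sqrt q * u) * b (x + \<tau>' / sqrt q * sqrt (q - A - u\<^sup>2))) else 0)"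
    proof (cases "2 * u\<^sup>2 \<le> q - A \<and> q \<le> 1")
      case True
      \<comment> \<open>From \<open>2 * u\<^sup>2 \<le> q - A\<close>, the difference
        \<open>q - A - u\<^sup>2\<close> is at least half of \<open>q - A\<close>, hence at least a
        quarter of it. If \<open>q = A\<close> then \<open>u = 0\<close>, and both sides are
        \<open>1 / 0 = 0\<close>.\<close>
      have "1 / (2 * sqrt (q - A - u\<^sup>2)) \<le> 1 / sqrt (q - A)"
      proof (cases "q - A = 0")
        case False
        have "0 < q - A" using True False by (smt (verit) zero_le_power2)
        have "sqrt (q - A) \<le> sqrt (4 * (q - A - u\<^sup>2))"
          using True \<open>0 < q - A\<close> by (intro real_sqrt_le_mono) simp
        also have "\<dots> = 2 * sqrt (q - A - u\<^sup>2)"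
          by (subst real_sqrt_mult) simp
        finally show ?thesis
          using \<open>0 < q - A\<close> by (intro frac_le) auto
      next
        case True
        with \<open>2 * u\<^sup>2 \<le> q - A \<and> q \<le> 1\<close> have "u = 0" by simp
        then show ?thesis using True by simp
      qed
      then have "ennreal (1 / (2 * sqrt (q - A - u\<^sup>2))) \<le> ennreal (1 / sqrt (q - A))"
        by (rule ennreal_leI)
      then have "P q * (a (x + \<tau> / sqrt q * u) * b (x + \<tau>' / sqrt q * sqrt (q - A - u\<^sup>2))) * ennreal (1 / (2 * sqrt (q - A - u\<^sup>2)))
        \<le> P q * (a (x + \<tau> / sqrt q * u) * b (x + \<tau>' / sqrt q * sqrt (q - A - u\<^sup>2))) * ennreal (1 / sqrt (q - A))"
        by (rule mult_left_mono) simp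
      then show ?thesis
        using True by (simp add: f_def mult_ac split: split_indicator)
    qed (auto simp: f_def split: split_indicator)
  qed
  finally show ?thesis .
qed

text \<open>With the squared norm \<open>q\<close> held fixed, \<open>sqrt q\<close> and
  \<open>P q\<close> are constants and the \<open>u\<close>-integral runs over an arc of radius
  \<open>\<rho> = sqrt (q - A)\<close>. The circle estimate costs \<open>12 * \<rho>\<close>, which
  cancels the density \<open>1 / \<rho>\<close>.\<close>

lemma nn_integral_half_slice_le:
  fixes A \<tau> \<tau>' x :: real
  assumes [measurable]: "P \<in> borel_measurable borel" "a \<in> borel_measurable borel" "b \<in> borel_measurable borel"
    and A: "0 \<le> A" and nz: "\<tau> \<noteq> 0" "\<tau>' \<noteq> 0"
  shows "(\<integral>\<^sup>+u. \<integral>\<^sup>+v. (if A + u\<^sup>2 + v\<^sup>2 \<le> 1 \<and> \<bar>u\<bar> \<le> v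
      then P (A + u\<^sup>2 + v\<^sup>2) * a (x + \<tau> / sqrt (A + u\<^sup>2 + v\<^sup>2) * u) * b (x + \<tau>' / sqrt (A + u\<^sup>2 + v\<^sup>2) * v) else 0) \<partial>lborel \<partial>lborel)
    \<le> 12 * (hl_root a x * hl_root b x) * (\<integral>\<^sup>+q\<in>{A..1}. P q \<partial>lborel)" (is "?L \<le> _")
proof -
  let ?H = "\<lambda>u q. (if 2 * u\<^sup>2 \<le> q - A \<and> q \<le> 1
      then P q * ennreal (1 / sqrt (q - A)) * (a (x + \<tau> / sqrt q * u) * b (x + \<tau>' / sqrt q * sqrt (q - A - u\<^sup>2))) else 0)"
  have "?L \<le> (\<integral>\<^sup>+u. \<integral>\<^sup>+q. ?H u q \<partial>lborel \<partial>lborel)"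
    by (intro nn_integral_mono nn_integral_sphere_coordinate_le A) auto
  also have "\<dots> = (\<integral>\<^sup>+q. \<integral>\<^sup>+u. ?H u q \<partial>lborel \<partial>lborel)"
    by (rule lborel_pair.Fubini') measurable
  also have "\<dots> \<le> (\<integral>\<^sup>+q. 12 * (hl_root a x * hl_root b x) * (P q * indicator {A..1} q) \<partial>lborel)"
  proof (rule nn_integral_mono)
    fix q
    consider "q < A \<or> 1 < q" | "q = A" | "A < q" "q \<le> 1" by linarith
    then show "(\<integral>\<^sup>+u. ?H u q \<partial>lborel) \<le> 12 * (hl_root a x * hl_root b x) * (P q * indicator {A..1} q)"
    proof cases
      case 1
      then have "?H u q = 0" for u by (smt (verit) zero_le_power2)
      then show ?thesis by simp
    next
      \<comment> \<open>Here the density \<open>1 / sqrt (q - A)\<close> is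
        \<open>1 / 0 = 0\<close>.\<close>
      case 2
      then have "?H u q = 0" for u by simp
      then show ?thesis by simp
    next
      case 3
      define \<rho> where "\<rho> = sqrt (q - A)"
      have \<rho>: "0 < \<rho>" "\<rho>\<^sup>2 = q - A" using 3 by (auto simp: \<rho>_def)
      have q: "0 < q" using A 3 by simp
      have "(\<integral>\<^sup>+u. ?H u q \<partial>lborel) = (\<integral>\<^sup>+u. P q * ennreal (1 / \<rho>) *
          (a (x + \<tau> / sqrt q * u) * b (x + \<tau>' / sqrt q * sqrt (\<rho>\<^sup>2 - u\<^sup>2)) * indicator {s. 2 * s\<^sup>2 \<le> \<rho>\<^sup>2} u) \<partial>lborel)"
        using 3 by (intro nn_integral_cong) (simp add: \<rho>(2) \<rho>_def[symmetric] split: split_indicator)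
      also have "\<dots> = P q * ennreal (1 / \<rho>) * (\<integral>\<^sup>+u.
          a (x + \<tau> / sqrt q * u) * b (x + \<tau>' / sqrt q * sqrt (\<rho>\<^sup>2 - u\<^sup>2)) * indicator {s. 2 * s\<^sup>2 \<le> \<rho>\<^sup>2} u \<partial>lborel)"
        by (rule nn_integral_cmult) measurable
      also have "\<dots> \<le> P q * ennreal (1 / \<rho>) * (ennreal (12 * \<rho>) * (hl_root a x * hl_root b x))"
        using q nz \<rho> by (intro mult_left_mono circle_le) auto
      also have "\<dots> = P q * (ennreal (1 / \<rho>) * ennreal (12 * \<rho>)) * (hl_root a x * hl_root b x)"
        by (simp add: mult_ac)
      also have "ennreal (1 / \<rho>) * ennreal (12 * \<rho>) = 12"
        using \<rho> by (simp add: ennreal_mult[symmetric])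
      finally show ?thesis using 3 by (simp add: mult_ac)
    qed
  qed
  also have "\<dots> = 12 * (hl_root a x * hl_root b x) * (\<integral>\<^sup>+q\<in>{A..1}. P q \<partial>lborel)"
    by (rule nn_integral_cmult) measurable
  finally show ?thesis .
qed

text \<open>The part with negative \<open>v\<close> is reflected, which changes the sign of
  \<open>\<tau>\<close> in \<open>b\<close> alone; for this the half slice has two separate
  parameters.\<close>

lemma nn_integral_slice_le:
  fixes A \<tau> x :: real
  assumes [measurable]: "P \<in> borel_measurable borel" "a \<in> borel_measurable borel" "b \<in> borel_measurable borel"
    and A: "0 \<le> A" and nz: "\<tau> \<noteq> 0"
  shows "(\<integral>\<^sup>+u. \<integral>\<^sup>+v. (if A + u\<^sup>2 + v\<^sup>2 \<le> 1 \<and> \<bar>u\<bar> \<le> \<bar>v\<bar>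
      then P (A + u\<^sup>2 + v\<^sup>2) * a (x + \<tau> / sqrt (A + u\<^sup>2 + v\<^sup>2) * u) * b (x + \<tau> / sqrt (A + u\<^sup>2 + v\<^sup>2) * v) else 0) \<partial>lborel \<partial>lborel)
    \<le> 24 * (hl_root a x * hl_root b x) * (\<integral>\<^sup>+q\<in>{A..1}. P q \<partial>lborel)" (is "?L \<le> _")
proof -
  define H where "H \<tau>' u v = (if A + u\<^sup>2 + v\<^sup>2 \<le> 1 \<and> \<bar>u\<bar> \<le> v
      then P (A + u\<^sup>2 + v\<^sup>2) * a (x + \<tau> / sqrt (A + u\<^sup>2 + v\<^sup>2) * u) * b (x + \<tau>' / sqrt (A + u\<^sup>2 + v\<^sup>2) * v) else 0)" for \<tau>' u v
  have [measurable]: "case_prod (H c) \<in> borel_measurable (borel \<Otimes>\<^sub>M borel)" for c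
    unfolding H_def by measurable
  have flip: "(\<integral>\<^sup>+v. H (- \<tau>) u (- v) \<partial>lborel) = (\<integral>\<^sup>+v. H (- \<tau>) u v \<partial>lborel)" for u
    using nn_integral_real_affine[of "H (- \<tau>) u" "-1" 0] by simp
  have "?L \<le> (\<integral>\<^sup>+u. \<integral>\<^sup>+v. H \<tau> u v + H (- \<tau>) u (- v) \<partial>lborel \<partial>lborel)"
    by (intro nn_integral_mono) (auto simp: H_def abs_if)
  also have "\<dots> = (\<integral>\<^sup>+u. (\<integral>\<^sup>+v. H \<tau> u v \<partial>lborel) + (\<integral>\<^sup>+v. H (- \<tau>) u v \<partial>lborel) \<partial>lborel)"
    by (intro nn_integral_cong) (simp add: nn_integral_add flip[symmetric])
  also have "\<dots> = (\<integral>\<^sup>+u. \<integral>\<^sup>+v. H \<tau> u v \<partial>lborel \<partial>lborel) + (\<integral>\<^sup>+u. \<integral>\<^sup>+v. H (- \<tau>) u v \<partial>lborel \<partial>lborel)"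
    by (rule nn_integral_add) measurable
  also have "\<dots> \<le> 12 * (hl_root a x * hl_root b x) * (\<integral>\<^sup>+q\<in>{A..1}. P q \<partial>lborel)
     + 12 * (hl_root a x * hl_root b x) * (\<integral>\<^sup>+q\<in>{A..1}. P q \<partial>lborel)"
    unfolding H_def using nz by (intro add_mono nn_integral_half_slice_le A) auto
  also have "\<dots> = (12 + 12) * (hl_root a x * hl_root b x) * (\<integral>\<^sup>+q\<in>{A..1}. P q \<partial>lborel)"
    by (simp only: distrib_right)
  also have "(12 + 12 :: ennreal) = 24" by simp
  finally show ?thesis .
qed

text \<open>The integral factors over the coordinates, and \<open>r \<le> 1\<close> bounds each
  constant \<open>4 * r\<close> by 4.\<close>

lemma nn_integral_cube_le_hl_max:
  fixes g :: "'i \<Rightarrow> real \<Rightarrow> ennreal"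
  assumes I: "finite I" and [measurable]: "\<And>i. g i \<in> borel_measurable borel" and "c \<noteq> 0" "0 \<le> r" "r \<le> 1"
  shows "(\<integral>\<^sup>+w. (\<Prod>i\<in>I. g i (x + c * w i) * indicator {-r..r} (w i)) \<partial>PiM I (\<lambda>_. lborel))
    \<le> 4 ^ card I * (\<Prod>i\<in>I. hl_max (g i) x)"
proof -
  interpret product_sigma_finite "\<lambda>_. lborel :: real measure" ..
  have "(\<integral>\<^sup>+w. (\<Prod>i\<in>I. g i (x + c * w i) * indicator {-r..r} (w i)) \<partial>PiM I (\<lambda>_. lborel))
      = (\<Prod>i\<in>I. (\<integral>\<^sup>+s\<in>{-r..r}. g i (x + c * s) \<partial>lborel))"
    by (rule product_nn_integral_prod) (use I in auto)
  also have "\<dots> \<le> (\<Prod>i\<in>I. 4 * hl_max (g i) x)"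
  proof (rule prod_mono_ennreal)
    fix i
    have "(\<integral>\<^sup>+s\<in>{-r..r}. g i (x + c * s) \<partial>lborel) \<le> ennreal (4 * r) * hl_max (g i) x"
      by (rule nn_integral_le_hl_max) (use assms in auto)
    also have "\<dots> \<le> ennreal 4 * hl_max (g i) x"
      using assms by (intro mult_right_mono ennreal_leI) auto
    finally show "(\<integral>\<^sup>+s\<in>{-r..r}. g i (x + c * s) \<partial>lborel) \<le> 4 * hl_max (g i) x" by simp
  qed
  also have "\<dots> = 4 ^ card I * (\<Prod>i\<in>I. hl_max (g i) x)"
    by (simp add: prod.distrib)
  finally show ?thesis .
qed

lemma nn_integral_ball_half_le:
  fixes g :: "'i \<Rightarrow> real \<Rightarrow> ennreal" and x \<tau> :: real
  assumes J: "finite J" "j \<notin> J" "k \<notin> J" "j \<noteq> k"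
    and [measurable]: "\<And>i. g i \<in> borel_measurable borel" and nz: "\<tau> \<noteq> 0" and I_def: "I = insert k (insert j J)"
  shows "(\<integral>\<^sup>+z. (if (\<Sum>i\<in>I. (z i)\<^sup>2) \<le> 1 \<and> \<bar>z j\<bar> \<le> \<bar>z k\<bar>
      then \<Prod>i\<in>I. g i (x + \<tau> / sqrt (\<Sum>i\<in>I. (z i)\<^sup>2) * z i) else 0) \<partial>PiM I (\<lambda>_. lborel))
    \<le> 24 * 4 ^ card J * (hl_root (g j) x * hl_root (g k) x * (\<Prod>i\<in>J. hl_max (g i) x))"
proof -
  interpret product_sigma_finite "\<lambda>_. lborel :: real measure" ..
  interpret J: finite_product_sigma_finite "\<lambda>_. lborel :: real measure" J
    by standard (rule J)
  interpret JL: pair_sigma_finite "PiM J (\<lambda>_. lborel :: real measure)" "lborel :: real measure" ..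
  let ?N = "hl_root (g j) x * hl_root (g k) x"
  define F where "F z = (if (\<Sum>i\<in>I. (z i)\<^sup>2) \<le> 1 \<and> \<bar>z j\<bar> \<le> \<bar>z k\<bar>
      then \<Prod>i\<in>I. g i (x + \<tau> / sqrt (\<Sum>i\<in>I. (z i)\<^sup>2) * z i) else 0)" for z :: "'i \<Rightarrow> real"
  define A where "A w = (\<Sum>i\<in>J. (w i)\<^sup>2)" for w :: "'i \<Rightarrow> real"
  define P where "P w q = (\<Prod>i\<in>J. g i (x + \<tau> / sqrt q * w i))" for w q
  have I: "finite I" "j \<in> I" "k \<in> I" "\<And>i. i \<in> J \<Longrightarrow> i \<in> I" using J by (auto simp: I_def)
  have comp [measurable]: "(\<lambda>z :: 'i \<Rightarrow> real. z i) \<in> borel_measurable (PiM I (\<lambda>_. lborel))" if "i \<in> I" for i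
    using measurable_component_singleton[OF that, of "\<lambda>_. lborel :: real measure"] by simp
  have [measurable]: "Measurable.pred (PiM I (\<lambda>_. lborel :: real measure)) (\<lambda>z. \<bar>z u\<bar> \<le> \<bar>z v\<bar>)"
    if "u \<in> I" "v \<in> I" for u v
    unfolding pred_def by (intro borel_measurable_le borel_measurable_abs comp that)
  have [measurable]: "(\<lambda>z :: 'i \<Rightarrow> real. z i) \<in> borel_measurable (PiM J (\<lambda>_. lborel))" if "i \<in> J" for i
    using measurable_component_singleton[OF that, of "\<lambda>_. lborel :: real measure"] by simp
  have F_meas: "F \<in> borel_measurable (PiM I (\<lambda>_. lborel))"
    unfolding F_def using I by measurable
  have A0: "0 \<le> A w" for w by (auto simp: A_def intro: sum_nonneg)
  have A_meas [measurable]: "A \<in> borel_measurable (PiM J (\<lambda>_. lborel))"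
    unfolding A_def by measurable
  have P_meas [measurable]: "(\<lambda>(w, q). P w q) \<in> borel_measurable (PiM J (\<lambda>_. lborel) \<Otimes>\<^sub>M borel)"
    unfolding P_def by measurable
  have P_meas' [measurable]: "P w \<in> borel_measurable borel" for w
    unfolding P_def by measurable
  have F_upd: "F (w(j := u, k := v)) = (if A w + u\<^sup>2 + v\<^sup>2 \<le> 1 \<and> \<bar>u\<bar> \<le> \<bar>v\<bar>
      then P w (A w + u\<^sup>2 + v\<^sup>2) * g j (x + \<tau> / sqrt (A w + u\<^sup>2 + v\<^sup>2) * u)
        * g k (x + \<tau> / sqrt (A w + u\<^sup>2 + v\<^sup>2) * v) else 0)" for w u v
  proof -
    let ?z = "w(j := u, k := v)"
    have "(\<Sum>i\<in>J. (?z i)\<^sup>2) = A w"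
      unfolding A_def using J by (intro sum.cong) auto
    then have S: "(\<Sum>i\<in>I. (?z i)\<^sup>2) = A w + u\<^sup>2 + v\<^sup>2"
      using J by (simp add: I_def)
    have "(\<Prod>i\<in>J. g i (x + \<tau> / sqrt (A w + u\<^sup>2 + v\<^sup>2) * ?z i)) = P w (A w + u\<^sup>2 + v\<^sup>2)"
      unfolding P_def using J by (intro prod.cong) auto
    then have "(\<Prod>i\<in>I. g i (x + \<tau> / sqrt (A w + u\<^sup>2 + v\<^sup>2) * ?z i)) = P w (A w + u\<^sup>2 + v\<^sup>2)
        * g j (x + \<tau> / sqrt (A w + u\<^sup>2 + v\<^sup>2) * u) * g k (x + \<tau> / sqrt (A w + u\<^sup>2 + v\<^sup>2) * v)"
      using J by (simp add: I_def mult_ac)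
    then show ?thesis
      unfolding F_def S using J by simp
  qed
  have F_meas': "(\<lambda>y. \<integral>\<^sup>+v. F (y(k := v)) \<partial>lborel) \<in> borel_measurable (PiM (insert j J) (\<lambda>_. lborel))"
  proof -
    have "(\<lambda>(y, v). F (y(k := v))) \<in> borel_measurable (PiM (insert j J) (\<lambda>_. lborel) \<Otimes>\<^sub>M lborel)"
      using measurable_compose[OF measurable_add_dim F_meas[unfolded I_def]] by (simp add: split_beta)
    then show ?thesis by measurable
  qed
  have "(\<integral>\<^sup>+z. F z \<partial>PiM I (\<lambda>_. lborel))
      = (\<integral>\<^sup>+w. \<integral>\<^sup>+u. \<integral>\<^sup>+v. F (w(j := u, k := v)) \<partial>lborel \<partial>lborel \<partial>PiM J (\<lambda>_. lborel))"
    unfolding I_def using J F_meas[unfolded I_def] F_meas'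
    by (simp add: product_nn_integral_insert)
  also have "\<dots> \<le> (\<integral>\<^sup>+w. 24 * ?N * (\<integral>\<^sup>+q\<in>{A w..1}. P w q \<partial>lborel) \<partial>PiM J (\<lambda>_. lborel))"
    unfolding F_upd using nz A0 by (intro nn_integral_mono nn_integral_slice_le) auto
  also have "\<dots> \<le> (\<integral>\<^sup>+w. 24 * ?N * (\<integral>\<^sup>+q. (if A w \<le> q \<and> q \<le> 1 then P w q else 0) \<partial>lborel) \<partial>PiM J (\<lambda>_. lborel))"
    by (intro nn_integral_mono mult_left_mono) (auto split: split_indicator)
  also have "\<dots> = 24 * ?N * (\<integral>\<^sup>+w. \<integral>\<^sup>+q. (if A w \<le> q \<and> q \<le> 1 then P w q else 0) \<partial>lborel \<partial>PiM J (\<lambda>_. lborel))"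
    by (rule nn_integral_cmult) measurable
  also have "\<dots> \<le> 24 * ?N * (4 ^ card J * (\<Prod>i\<in>J. hl_max (g i) x))"
  proof (rule mult_left_mono)
    have "(\<integral>\<^sup>+w. \<integral>\<^sup>+q. (if A w \<le> q \<and> q \<le> 1 then P w q else 0) \<partial>lborel \<partial>PiM J (\<lambda>_. lborel))
        = (\<integral>\<^sup>+q. \<integral>\<^sup>+w. (if A w \<le> q \<and> q \<le> 1 then P w q else 0) \<partial>PiM J (\<lambda>_. lborel) \<partial>lborel)"
      by (rule JL.Fubini'[symmetric]) measurable
    \<comment> \<open>For fixed \<open>q\<close> the dilation \<open>\<tau> / sqrt q\<close> is
      constant, and \<open>A w \<le> q\<close> confines \<open>w\<close> to the cube of half side
      \<open>sqrt q \<le> 1\<close>. The point \<open>q = 0\<close> is left out because the cube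
      estimate asks for a nonzero dilation.\<close>
    also have "\<dots> \<le> (\<integral>\<^sup>+q\<in>{0..1::real}. (4 ^ card J * (\<Prod>i\<in>J. hl_max (g i) x)) \<partial>lborel)"
    proof (rule nn_integral_mono_AE)
      show "AE q in lborel. (\<integral>\<^sup>+w. (if A w \<le> q \<and> q \<le> 1 then P w q else 0) \<partial>PiM J (\<lambda>_. lborel))
          \<le> 4 ^ card J * (\<Prod>i\<in>J. hl_max (g i) x) * indicator {0..1} q"
        using AE_lborel_singleton[of "0::real"]
      proof eventually_elim
        case (elim q)
        show ?case
        proof (cases "0 < q \<and> q \<le> 1")
          case True
          have "(\<integral>\<^sup>+w. (if A w \<le> q \<and> q \<le> 1 then P w q else 0) \<partial>PiM J (\<lambda>_. lborel))
            \<le> (\<integral>\<^sup>+w. (\<Prod>i\<in>J. g i (x + \<tau> / sqrt q * w i) * indicator {-sqrt q..sqrt q} (w i)) \<partial>PiM J (\<lambda>_. lborel))"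
          proof (rule nn_integral_mono)
            fix w
            show "(if A w \<le> q \<and> q \<le> 1 then P w q else 0)
              \<le> (\<Prod>i\<in>J. g i (x + \<tau> / sqrt q * w i) * indicator {-sqrt q..sqrt q} (w i))"
            proof (cases "A w \<le> q")
              case True
              have "w i \<in> {-sqrt q..sqrt q}" if "i \<in> J" for i
              proof -
                have "(w i)\<^sup>2 \<le> A w"
                  unfolding A_def using J that by (intro member_le_sum) auto
                then have "\<bar>w i\<bar> \<le> sqrt q"
                  using True by (intro real_le_rsqrt) auto
                then show ?thesis by auto
              qed
              then have "(\<Prod>i\<in>J. g i (x + \<tau> / sqrt q * w i) * indicator {-sqrt q..sqrt q} (w i)) = P w q"
                unfolding P_def by (intro prod.cong) auto
              then show ?thesis by simp
            qed simp
          qed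
          also have "\<dots> \<le> 4 ^ card J * (\<Prod>i\<in>J. hl_max (g i) x)"
            using True nz J by (intro nn_integral_cube_le_hl_max) auto
          finally show ?thesis using True by simp
        next
          case False
          then have no: "\<not> (A w \<le> q \<and> q \<le> 1)" for w
            using elim A0[of w] by auto
          show ?thesis
            unfolding if_not_P[OF no] by simp
        qed
      qed
    qed
    also have "\<dots> = 4 ^ card J * (\<Prod>i\<in>J. hl_max (g i) x)"
      by (subst nn_integral_cmult_indicator) auto
    finally show "(\<integral>\<^sup>+w. \<integral>\<^sup>+q. (if A w \<le> q \<and> q \<le> 1 then P w q else 0) \<partial>lborel \<partial>PiM J (\<lambda>_. lborel))
      \<le> 4 ^ card J * (\<Prod>i\<in>J. hl_max (g i) x)" .
  qed simp
  finally show ?thesis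
    unfolding F_def by (simp only: mult_ac)
qed

text \<open>One of \<open>\<bar>z j\<bar> \<le> \<bar>z k\<bar>\<close> and
  \<open>\<bar>z k\<bar> \<le> \<bar>z j\<bar>\<close> always holds, and the bound for such a half
  is symmetric in \<open>j\<close> and \<open>k\<close>; the two halves double the constant
  24.\<close>

lemma nn_integral_ball_le:
  fixes g :: "'i \<Rightarrow> real \<Rightarrow> ennreal" and x \<tau> :: real
  assumes I: "finite I" "j \<in> I" "k \<in> I" "j \<noteq> k"
    and [measurable]: "\<And>i. g i \<in> borel_measurable borel" and nz: "\<tau> \<noteq> 0"
  shows "(\<integral>\<^sup>+z. (if (\<Sum>i\<in>I. (z i)\<^sup>2) \<le> 1
      then \<Prod>i\<in>I. g i (x + \<tau> / sqrt (\<Sum>i\<in>I. (z i)\<^sup>2) * z i) else 0) \<partial>PiM I (\<lambda>_. lborel))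
    \<le> 48 * 4 ^ card I * (hl_root (g j) x * hl_root (g k) x * (\<Prod>i\<in>I - {j, k}. hl_max (g i) x))"
proof -
  define J where "J = I - {j, k}"
  have J: "finite J" "j \<notin> J" "k \<notin> J" "I = insert k (insert j J)" "I = insert j (insert k J)"
    using I by (auto simp: J_def)
  define H where "H u v z = (if (\<Sum>i\<in>I. (z i)\<^sup>2) \<le> 1 \<and> \<bar>z u\<bar> \<le> \<bar>z v\<bar>
      then \<Prod>i\<in>I. g i (x + \<tau> / sqrt (\<Sum>i\<in>I. (z i)\<^sup>2) * z i) else 0)" for u v and z :: "'i \<Rightarrow> real"
  have comp [measurable]: "(\<lambda>z :: 'i \<Rightarrow> real. z i) \<in> borel_measurable (PiM I (\<lambda>_. lborel))" if "i \<in> I" for i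
    using measurable_component_singleton[OF that, of "\<lambda>_. lborel :: real measure"] by simp
  have [measurable]: "Measurable.pred (PiM I (\<lambda>_. lborel :: real measure)) (\<lambda>z. \<bar>z u\<bar> \<le> \<bar>z v\<bar>)"
    if "u \<in> I" "v \<in> I" for u v
    unfolding pred_def by (intro borel_measurable_le borel_measurable_abs comp that)
  have [measurable]: "H j k \<in> borel_measurable (PiM I (\<lambda>_. lborel))" "H k j \<in> borel_measurable (PiM I (\<lambda>_. lborel))"
    unfolding H_def using I by measurable
  let ?B = "hl_root (g j) x * hl_root (g k) x * (\<Prod>i\<in>J. hl_max (g i) x)"
  have "(\<integral>\<^sup>+z. H j k z \<partial>PiM I (\<lambda>_. lborel)) \<le> 24 * 4 ^ card J * ?B"
    unfolding H_def by (rule nn_integral_ball_half_le[OF J(1,2,3) I(4) assms(5) nz J(4)])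
  moreover have "(\<integral>\<^sup>+z. H k j z \<partial>PiM I (\<lambda>_. lborel)) \<le> 24 * 4 ^ card J * ?B"
    using nn_integral_ball_half_le[OF J(1,3,2) I(4)[symmetric] _ nz J(5), of g x]
    unfolding H_def by (simp add: mult_ac)
  ultimately have "(\<integral>\<^sup>+z. H j k z \<partial>PiM I (\<lambda>_. lborel)) + (\<integral>\<^sup>+z. H k j z \<partial>PiM I (\<lambda>_. lborel))
      \<le> 24 * 4 ^ card J * ?B + 24 * 4 ^ card J * ?B"
    by (rule add_mono)
  also have "\<dots> = (24 + 24) * 4 ^ card J * ?B"
    by (simp only: distrib_right)
  also have "\<dots> \<le> 48 * 4 ^ card I * ?B"
  proof -
    have "(4::ennreal) ^ card J \<le> 4 ^ card I"
      using I by (intro power_increasing card_mono) (auto simp: J_def)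
    then show ?thesis by (intro mult_right_mono mult_mono) auto
  qed
  finally have sum: "(\<integral>\<^sup>+z. H j k z + H k j z \<partial>PiM I (\<lambda>_. lborel)) \<le> 48 * 4 ^ card I * ?B"
    by (simp add: nn_integral_add)
  show ?thesis
    unfolding J_def[symmetric]
    by (rule order_trans[OF nn_integral_mono sum]) (auto simp: H_def)
qed

text \<open>The measure is the law of \<open>sgn z\<close> for \<open>z\<close> uniform in the ball,
  so the argument \<open>x - t * y $ i\<close> becomes \<open>x + \<tau> / norm z * z $ i\<close>
  with \<open>\<tau> = - t\<close>. The ball is then integrated in coordinates.\<close>

lemma nn_integral_sphere_measure_le:
  fixes g :: "'m::finite \<Rightarrow> real \<Rightarrow> ennreal"
  assumes [measurable]: "\<And>i. g i \<in> borel_measurable borel" and jk: "j \<noteq> k" and t: "t \<noteq> 0"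
  shows "(\<integral>\<^sup>+y. (\<Prod>i\<in>UNIV. g i (x - t * y $ i)) \<partial>(sphere_measure :: (real ^ 'm) measure))
    \<le> 48 * 4 ^ CARD('m) / emeasure lborel (cball (0 :: real ^ 'm) 1)
      * (hl_root (g j) x * hl_root (g k) x * (\<Prod>i\<in>UNIV - {j, k}. hl_max (g i) x))"
proof -
  let ?B = "Basis :: (real ^ 'm) set" and ?ax = "\<lambda>i :: 'm. axis i (1::real)"
  \<comment> \<open>Lebesgue measure is a product indexed by basis vectors; \<open>idx\<close>
    recovers the coordinate from the basis vector.\<close>
  define idx where "idx = inv ?ax"
  have inj: "inj ?ax" by (auto simp: inj_on_def axis_eq_axis)
  have idx [simp]: "idx (?ax i) = i" for i
    unfolding idx_def by (rule inv_f_f[OF inj])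
  have bij: "bij_betw ?ax UNIV ?B"
    using inj by (auto simp: bij_betw_def Basis_vec_def)
  let ?V = "\<lambda>f. (\<Sum>b\<in>?B. f b *\<^sub>R b)"
  have V_inner: "?V f \<bullet> b = f b" if "b \<in> ?B" for f b
    using that by simp
  have V_nth: "?V f $ i = f (?ax i)" for f i
    using V_inner[of "?ax i" f] by (simp add: cart_eq_inner_axis del: inner_sum_left_Basis)
  have V_norm: "norm (?V f) = sqrt (\<Sum>b\<in>?B. (f b)\<^sup>2)" for f
  proof -
    have "?V f \<bullet> ?V f = (\<Sum>b\<in>?B. (?V f \<bullet> b) * (?V f \<bullet> b))"
      by (rule euclidean_inner)
    also have "\<dots> = (\<Sum>b\<in>?B. (f b)\<^sup>2)"
      by (intro sum.cong refl) (simp only: V_inner power2_eq_square)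
    finally show ?thesis
      by (simp only: norm_eq_sqrt_inner)
  qed
  have [measurable]: "(\<lambda>y :: real ^ 'm. y $ i) \<in> borel_measurable borel" for i
    by (intro borel_measurable_continuous_onI continuous_intros)
  let ?F = "\<lambda>y :: real ^ 'm. \<Prod>i\<in>UNIV. g i (x - t * y $ i)"
  have F_meas [measurable]: "?F \<in> borel_measurable borel"
    by measurable
  have F_sgn [measurable]: "(\<lambda>z. ?F (sgn z)) \<in> borel_measurable borel"
    by (rule measurable_compose[OF sgn_measurable_euclidean F_meas])
  have G_meas: "(\<lambda>z. ?F (sgn z) * indicator (cball 0 1) z) \<in> borel_measurable borel"
    by (intro borel_measurable_times_ennreal borel_measurable_indicator F_sgn) simp
  have "(\<integral>\<^sup>+z. ?F (sgn z) * indicator (cball 0 1) z \<partial>(lborel :: (real ^ 'm) measure))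
    = (\<integral>\<^sup>+f. ?F (sgn (?V f)) * indicator (cball 0 1) (?V f) \<partial>PiM ?B (\<lambda>_. lborel))"
    by (subst lborel_eq, subst nn_integral_distr) (use G_meas in simp_all)
  also have "\<dots> = (\<integral>\<^sup>+f. (if (\<Sum>b\<in>?B. (f b)\<^sup>2) \<le> 1
      then \<Prod>b\<in>?B. g (idx b) (x + (- t) / sqrt (\<Sum>b\<in>?B. (f b)\<^sup>2) * f b) else 0) \<partial>PiM ?B (\<lambda>_. lborel))"
  proof (rule nn_integral_cong)
    fix f
    have "?F (sgn (?V f)) = (\<Prod>i\<in>UNIV. g (idx (?ax i)) (x + (- t) / sqrt (\<Sum>b\<in>?B. (f b)\<^sup>2) * f (?ax i)))"
      by (simp only: sgn_div_norm V_norm vector_scaleR_component V_nth idx) (simp add: field_simps)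
    also have "\<dots> = (\<Prod>b\<in>?B. g (idx b) (x + (- t) / sqrt (\<Sum>b\<in>?B. (f b)\<^sup>2) * f b))"
      by (rule prod.reindex_bij_betw[OF bij])
    finally show "?F (sgn (?V f)) * indicator (cball 0 1) (?V f) = (if (\<Sum>b\<in>?B. (f b)\<^sup>2) \<le> 1
      then \<Prod>b\<in>?B. g (idx b) (x + (- t) / sqrt (\<Sum>b\<in>?B. (f b)\<^sup>2) * f b) else 0)"
      by (simp add: indicator_def V_norm del: sum.cong)
  qed
  also have "\<dots> \<le> 48 * 4 ^ card ?B * (hl_root (g (idx (?ax j))) x * hl_root (g (idx (?ax k))) x
      * (\<Prod>b\<in>?B - {?ax j, ?ax k}. hl_max (g (idx b)) x))"
    using jk t by (intro nn_integral_ball_le) (auto simp: axis_eq_axis)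
  also have "(\<Prod>b\<in>?B - {?ax j, ?ax k}. hl_max (g (idx b)) x) = (\<Prod>i\<in>UNIV - {j, k}. hl_max (g i) x)"
  proof -
    have "bij_betw ?ax (UNIV - {j, k}) (?B - {?ax j, ?ax k})"
      using bij inj by (auto simp: bij_betw_def inj_on_def)
    then have "(\<Prod>b\<in>?B - {?ax j, ?ax k}. hl_max (g (idx b)) x) = (\<Prod>i\<in>UNIV - {j, k}. hl_max (g (idx (?ax i))) x)"
      by (rule prod.reindex_bij_betw[symmetric])
    then show ?thesis by simp
  qed
  finally have ball: "(\<integral>\<^sup>+z. ?F (sgn z) * indicator (cball 0 1) z \<partial>(lborel :: (real ^ 'm) measure))
    \<le> 48 * 4 ^ CARD('m) * (hl_root (g j) x * hl_root (g k) x * (\<Prod>i\<in>UNIV - {j, k}. hl_max (g i) x))"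
    by simp
  have "(\<integral>\<^sup>+y. ?F y \<partial>sphere_measure) = (\<integral>\<^sup>+z. ?F (sgn z) \<partial>uniform_measure lborel (cball 0 1))"
    unfolding sphere_measure_def by (rule nn_integral_distr) (use F_meas in simp_all)
  also have "\<dots> = (\<integral>\<^sup>+z. ?F (sgn z) * indicator (cball 0 1) z \<partial>lborel) / emeasure lborel (cball (0 :: real ^ 'm) 1)"
    by (rule nn_integral_uniform_measure) (use F_sgn in simp_all)
  also have "\<dots> \<le> 48 * 4 ^ CARD('m) * (hl_root (g j) x * hl_root (g k) x * (\<Prod>i\<in>UNIV - {j, k}. hl_max (g i) x))
      / emeasure lborel (cball (0 :: real ^ 'm) 1)"
    by (rule divide_right_mono_ennreal[OF ball])
  finally show ?thesis
    by (simp add: ennreal_times_divide mult_ac)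
qed

text \<open>The bound for a fixed radius does not involve \<open>t\<close>, so it passes to the
  supremum.\<close>

lemma spherical_maximal_le:
  fixes f :: "'m::finite \<Rightarrow> real \<Rightarrow> complex"
  assumes [measurable]: "\<And>i. f i \<in> borel_measurable borel" and jk: "j \<noteq> k"
  defines "g \<equiv> \<lambda>i y. ennreal (cmod (f i y))"
  shows "spherical_maximal f x \<le> 48 * 4 ^ CARD('m) / emeasure lborel (cball (0 :: real ^ 'm) 1)
      * (hl_root (g j) x * hl_root (g k) x * (\<Prod>i\<in>UNIV - {j, k}. hl_max (g i) x))"
  unfolding spherical_maximal_def
proof (rule SUP_least)
  fix t :: real assume "t \<in> {0<..}"
  then have t: "t \<noteq> 0" by simp
  let ?F = "\<lambda>y :: real ^ 'm. \<Prod>i\<in>UNIV. f i (x - t * y $ i)"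
  \<comment> \<open>For a non-integrable integrand the Bochner integral is 0 by convention.\<close>
  have "ennreal (cmod (LINT y|sphere_measure. ?F y)) \<le> (\<integral>\<^sup>+y. ennreal (cmod (?F y)) \<partial>sphere_measure)"
    by (cases "integrable sphere_measure ?F")
       (auto simp: integral_norm_bound_ennreal not_integrable_integral_eq)
  also have "\<dots> = (\<integral>\<^sup>+y. (\<Prod>i\<in>UNIV. g i (x - t * y $ i)) \<partial>(sphere_measure :: (real ^ 'm) measure))"
    by (simp add: g_def prod_norm[symmetric] prod_ennreal)
  also have "\<dots> \<le> 48 * 4 ^ CARD('m) / emeasure lborel (cball (0 :: real ^ 'm) 1)
      * (hl_root (g j) x * hl_root (g k) x * (\<Prod>i\<in>UNIV - {j, k}. hl_max (g i) x))"
    using jk t by (intro nn_integral_sphere_measure_le) (auto simp: g_def)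
  finally show "ennreal (cmod (LINT y|sphere_measure. ?F y)) \<le> 48 * 4 ^ CARD('m) / emeasure lborel (cball (0 :: real ^ 'm) 1)
      * (hl_root (g j) x * hl_root (g k) x * (\<Prod>i\<in>UNIV - {j, k}. hl_max (g i) x))" .
qed

section \<open>Weak type estimates\<close>

lemma hl_max_eq_0:
  assumes [measurable]: "g \<in> borel_measurable borel" and "(\<integral>\<^sup>+y. g y \<partial>lborel) = 0"
  shows "hl_max g x = 0"
proof -
  have "(\<integral>\<^sup>+s\<in>{-r..r}. g (x + s) \<partial>lborel) = 0" for r
  proof -
    have "(\<integral>\<^sup>+s\<in>{-r..r}. g (x + s) \<partial>lborel) \<le> (\<integral>\<^sup>+s. g (x + s) \<partial>lborel)"
      by (intro nn_integral_mono) (auto split: split_indicator)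
    also have "\<dots> = (\<integral>\<^sup>+y. g y \<partial>lborel)"
      using nn_integral_real_affine[of g 1 x] by simp
    finally show ?thesis using assms by simp
  qed
  then have "hl_max g x \<le> 0"
    unfolding hl_max_def by (intro SUP_least) simp
  then show ?thesis by simp
qed

lemma sqrt_hl_max_null:
  assumes "E \<in> sets borel" "emeasure lborel E = 0"
  shows "sqrt_hl_max E x = 0"
  using assms hl_max_eq_0[of "indicator E" x] by (simp add: sqrt_hl_max_def)

lemma sqrt_hl_max_le_1: "sqrt_hl_max E x \<le> 1"
proof -
  have "enn2real (hl_max (indicator E) x) \<le> 1"
    using enn2real_mono[OF hl_max_indicator_le_1[of E x]] by simp
  then show ?thesis
    by (simp add: sqrt_hl_max_def)
qed

lemma borel_measurable_sqrt_hl_max [measurable]: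
  assumes [measurable]: "E \<in> sets borel"
  shows "sqrt_hl_max E \<in> borel_measurable borel"
proof -
  have "(\<lambda>w :: real \<times> real. indicator E (snd w) :: ennreal) \<in> borel_measurable (borel \<Otimes>\<^sub>M borel)"
    by (rule measurable_compose[OF measurable_snd]) simp
  then have *: "(\<lambda>(z :: real, y). indicator E y :: ennreal) \<in> borel_measurable (borel \<Otimes>\<^sub>M borel)"
    by (simp only: split_beta')
  show "sqrt_hl_max E \<in> borel_measurable borel"
    by (rule borel_measurable_sqrt_hl_max_param[OF * measurable_ident_sets[OF refl]])
qed

lemma borel_measurable_hl_root [measurable]:
  assumes [measurable]: "g \<in> borel_measurable borel"
  shows "hl_root g \<in> borel_measurable borel"
    "(\<lambda>(x, l). sqrt_hl_max {y. ennreal l < g y} x) \<in> borel_measurable (borel \<Otimes>\<^sub>M borel)"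
proof -
  have "(\<lambda>(z, y). indicator {y. ennreal (snd z) < g y} y :: ennreal) \<in> borel_measurable ((borel \<Otimes>\<^sub>M borel) \<Otimes>\<^sub>M borel)"
    unfolding indicator_def mem_Collect_eq by measurable
  then have "(\<lambda>z. sqrt_hl_max {y. ennreal (snd z) < g y} (fst z)) \<in> borel_measurable (borel \<Otimes>\<^sub>M borel)"
    by (rule borel_measurable_sqrt_hl_max_param) measurable
  then show 1: "(\<lambda>(x, l). sqrt_hl_max {y. ennreal l < g y} x) \<in> borel_measurable (borel \<Otimes>\<^sub>M borel)"
    by (simp add: split_beta)
  have [measurable]: "(\<lambda>(x, l). sqrt_hl_max {y. ennreal l < g y} x) \<in> borel_measurable (borel \<Otimes>\<^sub>M lborel)"
    using 1 by (simp cong: measurable_cong_sets sets_pair_measure_cong)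
  show "hl_root g \<in> borel_measurable borel"
    unfolding hl_root_def by measurable
qed

text \<open>Squaring the level turns the weak type inequality for the maximal function of an
  indicator into decay of order \<open>1 / a\<^sup>2\<close>, which is integrable at
  infinity.\<close>

lemma emeasure_sqrt_hl_max_le:
  assumes [measurable]: "E \<in> sets borel" and a: "0 < a" and m: "emeasure lborel E = ennreal m" "0 \<le> m"
  shows "emeasure lborel {x. ennreal a < sqrt_hl_max E x} \<le> ennreal (5 * m / a\<^sup>2)"
proof -
  have sub: "{x. ennreal a < sqrt_hl_max E x} \<subseteq> {x. ennreal (a\<^sup>2) < hl_max (indicator E) x}"
  proof safe
    fix x assume "ennreal a < sqrt_hl_max E x"
    then have "a < sqrt (enn2real (hl_max (indicator E) x))"
      using a by (simp add: sqrt_hl_max_def ennreal_less_iff)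
    then have "a\<^sup>2 < enn2real (hl_max (indicator E) x)"
      using a real_less_rsqrt real_sqrt_less_iff[of "a\<^sup>2" "enn2real (hl_max (indicator E) x)"] by simp
    moreover have "hl_max (indicator E) x = ennreal (enn2real (hl_max (indicator E) x))"
      using le_less_trans[OF hl_max_indicator_le_1 ennreal_one_less_top] by simp
    ultimately show "ennreal (a\<^sup>2) < hl_max (indicator E) x"
      by (metis ennreal_less_iff zero_le_power2)
  qed
  have [measurable]: "hl_max (indicator E) \<in> borel_measurable borel"
    by (rule borel_measurable_hl_max) simp
  have "ennreal (a\<^sup>2) * emeasure lborel {x. ennreal a < sqrt_hl_max E x}
      \<le> ennreal (a\<^sup>2) * emeasure lborel {x. ennreal (a\<^sup>2) < hl_max (indicator E) x}"
    by (intro mult_left_mono emeasure_mono sub) auto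
  also have "\<dots> \<le> 5 * (\<integral>\<^sup>+x. indicator E x \<partial>lborel)"
    using a by (intro hl_max_weak_type) auto
  also have "\<dots> = ennreal (5 * m)"
    using m by (simp add: ennreal_mult)
  also have "\<dots> = ennreal (a\<^sup>2) * ennreal (5 * m / a\<^sup>2)"
    using a m by (simp add: ennreal_mult[symmetric])
  finally show ?thesis
    using a by (simp add: ennreal_mult_le_mult_iff)
qed

text \<open>Kolmogorov's argument: in the layer-cake integral over \<open>S\<close>, the part of
  \<open>S\<close> above a level has measure at most \<open>s\<close>, used up to the level
  \<open>\<delta>\<close>; beyond it the weak type decay is integrated.\<close>

lemma nn_integral_sqrt_hl_max_le_aux:
  assumes [measurable]: "E \<in> sets borel" "S \<in> sets borel"
    and m: "emeasure lborel E = ennreal m" "0 \<le> m" and s: "emeasure lborel S = ennreal s" "0 \<le> s"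
    and \<delta>: "0 < \<delta>"
  shows "(\<integral>\<^sup>+x\<in>S. sqrt_hl_max E x \<partial>lborel) \<le> ennreal (\<delta> * s + 5 * m / \<delta>)"
proof -
  let ?\<phi> = "sqrt_hl_max E"
  have "(\<integral>\<^sup>+x\<in>S. ?\<phi> x \<partial>lborel)
      = (\<integral>\<^sup>+x. (\<integral>\<^sup>+a. (if ennreal a < ?\<phi> x \<and> x \<in> S \<and> 0 \<le> a then 1 else 0) \<partial>lborel) \<partial>lborel)"
  proof (rule nn_integral_cong)
    fix x
    have "?\<phi> x * indicator S x = (\<integral>\<^sup>+a\<in>{0..}. indicator {y. ennreal a < ?\<phi> y} x \<partial>lborel) * indicator S x"
      by (simp only: nn_integral_superlevel)
    also have "\<dots> = (\<integral>\<^sup>+a. (if ennreal a < ?\<phi> x \<and> x \<in> S \<and> 0 \<le> a then 1 else 0) \<partial>lborel)"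
      by (cases "x \<in> S") (auto intro!: nn_integral_cong split: split_indicator)
    finally show "?\<phi> x * indicator S x = (\<integral>\<^sup>+a. (if ennreal a < ?\<phi> x \<and> x \<in> S \<and> 0 \<le> a then 1 else 0) \<partial>lborel)" .
  qed
  also have "\<dots> = (\<integral>\<^sup>+a. (\<integral>\<^sup>+x. (if ennreal a < ?\<phi> x \<and> x \<in> S \<and> 0 \<le> a then 1 else 0) \<partial>lborel) \<partial>lborel)"
    by (rule lborel_pair.Fubini') measurable
  also have "\<dots> \<le> (\<integral>\<^sup>+a. ennreal s * indicator {0..\<delta>} a + ennreal (5 * m / a\<^sup>2) * indicator {\<delta>..} a \<partial>lborel)"
  proof (rule nn_integral_mono)
    fix a :: real
    have "(\<integral>\<^sup>+x. (if ennreal a < ?\<phi> x \<and> x \<in> S \<and> 0 \<le> a then 1 else 0) \<partial>lborel) \<le> ennreal s" if "0 \<le> a" "a \<le> \<delta>"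
    proof -
      have "(\<integral>\<^sup>+x. (if ennreal a < ?\<phi> x \<and> x \<in> S \<and> 0 \<le> a then 1 else 0) \<partial>lborel) \<le> (\<integral>\<^sup>+x. indicator S x \<partial>lborel)"
        by (intro nn_integral_mono) auto
      then show ?thesis using s by simp
    qed
    moreover have "(\<integral>\<^sup>+x. (if ennreal a < ?\<phi> x \<and> x \<in> S \<and> 0 \<le> a then 1 else 0) \<partial>lborel) \<le> ennreal (5 * m / a\<^sup>2)" if "\<delta> < a"
    proof -
      have "(\<integral>\<^sup>+x. (if ennreal a < ?\<phi> x \<and> x \<in> S \<and> 0 \<le> a then 1 else 0) \<partial>lborel) \<le> (\<integral>\<^sup>+x. indicator {x. ennreal a < ?\<phi> x} x \<partial>lborel)"
        by (intro nn_integral_mono) auto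
      also have "\<dots> = emeasure lborel {x. ennreal a < ?\<phi> x}"
        by (rule nn_integral_indicator) measurable
      also have "\<dots> \<le> ennreal (5 * m / a\<^sup>2)"
        using that \<delta> m by (intro emeasure_sqrt_hl_max_le) auto
      finally show ?thesis .
    qed
    ultimately show "(\<integral>\<^sup>+x. (if ennreal a < ?\<phi> x \<and> x \<in> S \<and> 0 \<le> a then 1 else 0) \<partial>lborel)
        \<le> ennreal s * indicator {0..\<delta>} a + ennreal (5 * m / a\<^sup>2) * indicator {\<delta>..} a"
      using \<delta> by (cases "a < 0"; cases "a \<le> \<delta>") (auto split: split_indicator intro: add_increasing2)
  qed
  also have "\<dots> = (\<integral>\<^sup>+a. ennreal s * indicator {0..\<delta>} a \<partial>lborel) + (\<integral>\<^sup>+a. ennreal (5 * m / a\<^sup>2) * indicator {\<delta>..} a \<partial>lborel)"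
    by (rule nn_integral_add) measurable
  also have "(\<integral>\<^sup>+a. ennreal s * indicator {0..\<delta>} a \<partial>lborel) = ennreal (\<delta> * s)"
    using \<delta> s by (simp add: nn_integral_cmult_indicator ennreal_mult[symmetric] mult.commute)
  also have "(\<integral>\<^sup>+a. ennreal (5 * m / a\<^sup>2) * indicator {\<delta>..} a \<partial>lborel) = ennreal (0 - - (5 * m) / \<delta>)"
  proof (rule nn_integral_FTC_atLeast)
    show "((\<lambda>a. - (5 * m) / a) has_real_derivative 5 * m / a\<^sup>2) (at a)" if "\<delta> \<le> a" for a
      using that \<delta> by (auto intro!: derivative_eq_intros simp: power2_eq_square)
    show "((\<lambda>a. - (5 * m) / a) \<longlongrightarrow> 0) at_top"
      by (rule tendsto_divide_0[OF tendsto_const filterlim_at_top_imp_at_infinity[OF filterlim_ident]])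
  qed (use m in auto)
  also have "ennreal (\<delta> * s) + ennreal (0 - - (5 * m) / \<delta>) = ennreal (\<delta> * s + 5 * m / \<delta>)"
    using m s \<delta> by (simp add: ennreal_plus[symmetric] del: ennreal_plus)
  finally show ?thesis .
qed

text \<open>For \<open>0 < m \<le> s\<close>, with \<open>m\<close> the measure of \<open>E\<close>,
  the choice \<open>\<delta> = sqrt m / sqrt s\<close> gives \<open>6 * sqrt s * sqrt m\<close>.
  This is the claimed bound times \<open>(m / s) powr (1 / 2 - e)\<close>, which is at most 1
  because \<open>e \<le> 1 / 2\<close>. For \<open>m > s\<close> the integral is at most
  \<open>s\<close>, since the integrand is at most 1.\<close>

lemma nn_integral_sqrt_hl_max_le:
  assumes [measurable]: "E \<in> sets borel" "S \<in> sets borel"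
    and s: "emeasure lborel S = ennreal s" "0 < s" and e: "0 < e" "e \<le> 1 / 2"
  shows "(\<integral>\<^sup>+x\<in>S. sqrt_hl_max E x \<partial>lborel) \<le> ennreal (6 * s powr (1 - e)) * ennreal_powr (emeasure lborel E) e"
    (is "?I \<le> _")
proof (cases "emeasure lborel E" rule: ennreal_cases)
  case top
  then show ?thesis using s by (simp add: ennreal_powr_def ennreal_mult_top)
next
  case (real m)
  have aux: "?I \<le> ennreal (\<delta> * s + 5 * m / \<delta>)" if "0 < \<delta>" for \<delta>
    using nn_integral_sqrt_hl_max_le_aux[OF assms(1,2) real(2,1) s(1) less_imp_le[OF s(2)] that] .
  have "?I \<le> ennreal (6 * s powr (1 - e) * m powr e)"
  proof -
    consider "m = 0" | "0 < m" "m \<le> s" | "s < m" using real by linarith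
    then show ?thesis
    proof cases
      case 1
      \<comment> \<open>For \<open>m = 0\<close> let \<open>\<delta>\<close> tend to 0.\<close>
      have "?I \<le> 0 + ennreal \<epsilon>" if "0 < \<epsilon>" for \<epsilon>
        using aux[of "\<epsilon> / s"] that s 1 by simp
      then have "?I \<le> 0"
        by (rule ennreal_le_epsilon)
      then show ?thesis by simp
    next
      case 2
      let ?a = "sqrt m" and ?b = "sqrt s"
      have ab: "0 < ?a" "0 < ?b" using 2 s by auto
      have id: "a / b * (b * b) + 5 * (a * a) / (a / b) = 6 * (b * a)" if "0 < a" "0 < b" for a b :: real
        using that by (simp add: field_simps)
      have "?a / ?b * s + 5 * m / (?a / ?b) = 6 * (?b * ?a)"
        using id[OF ab] 2 s by simp
      then have "?I \<le> ennreal (6 * (?b * ?a))"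
        using aux[of "?a / ?b"] ab by simp
      also have "6 * (?b * ?a) \<le> 6 * s powr (1 - e) * m powr e"
      proof -
        have "?b = s powr (1 - e) * s powr (e - 1 / 2)"
          using s by (simp add: powr_add[symmetric] powr_half_sqrt)
        moreover have "?a = m powr e * m powr (1 / 2 - e)"
          using 2 by (simp add: powr_add[symmetric] powr_half_sqrt)
        moreover have "s powr (e - 1 / 2) * m powr (1 / 2 - e) \<le> 1"
        proof -
          have "m powr (1 / 2 - e) \<le> s powr (1 / 2 - e)"
            using 2 e by (intro powr_mono2) auto
          then have "s powr (e - 1 / 2) * m powr (1 / 2 - e) \<le> s powr (e - 1 / 2) * s powr (1 / 2 - e)"
            by (rule mult_left_mono) simp
          then show ?thesis using s by (simp add: powr_add[symmetric])
        qed
        then have "s powr (1 - e) * m powr e * (s powr (e - 1 / 2) * m powr (1 / 2 - e)) \<le> s powr (1 - e) * m powr e * 1"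
          by (rule mult_left_mono) simp
        ultimately show ?thesis by (simp add: mult_ac)
      qed
      finally show ?thesis by (simp add: ennreal_leI)
    next
      case 3
      have "?I \<le> (\<integral>\<^sup>+x. indicator S x \<partial>lborel)"
        using sqrt_hl_max_le_1[of E] by (intro nn_integral_mono) (auto split: split_indicator)
      also have "\<dots> = ennreal s" using s by simp
      also have "\<dots> \<le> ennreal (6 * s powr (1 - e) * m powr e)"
      proof (rule ennreal_leI)
        have "s = s powr (1 - e) * s powr e"
          using s by (simp add: powr_add[symmetric])
        also have "\<dots> \<le> s powr (1 - e) * m powr e"
          using 3 s e by (intro mult_left_mono powr_mono2) auto
        also have "\<dots> \<le> 6 * s powr (1 - e) * m powr e" by simp
        finally show "s \<le> 6 * s powr (1 - e) * m powr e" .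
      qed
      finally show ?thesis .
    qed
  qed
  then show ?thesis
    using real s by (simp add: ennreal_powr_def ennreal_mult)
qed

section \<open>Weak type bounds in terms of layer integrals\<close>

text \<open>Up to a constant factor, the Lorentz norm with exponents \<open>1/e\<close> and \<open>1\<close>.\<close>

definition lorentz_layer :: "real \<Rightarrow> (real \<Rightarrow> ennreal) \<Rightarrow> ennreal" where
  "lorentz_layer e g = (\<integral>\<^sup>+l\<in>{0..}. ennreal_powr (distribution_fun lborel g (ennreal l)) e \<partial>lborel)"

lemma borel_measurable_ennreal_powr [measurable]: "(\<lambda>a. ennreal_powr a e) \<in> borel_measurable borel"
  unfolding ennreal_powr_def by measurable

lemma borel_measurable_distribution_fun [measurable]:
  assumes [measurable]: "g \<in> borel_measurable borel"
  shows "(\<lambda>l. distribution_fun lborel g (ennreal l)) \<in> borel_measurable borel"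
proof -
  have "distribution_fun lborel g (ennreal l) = (\<integral>\<^sup>+y. indicator {y. ennreal l < g y} y \<partial>lborel)" for l
    unfolding distribution_fun_def by (subst nn_integral_indicator) auto
  moreover have "(\<lambda>l. \<integral>\<^sup>+y. indicator {y. ennreal l < g y} y \<partial>lborel) \<in> borel_measurable borel"
    unfolding indicator_def mem_Collect_eq by measurable
  ultimately show ?thesis by simp
qed

text \<open>\<open>hl_root\<close> is an integral over levels, so Tonelli reduces the claim to
  Kolmogorov's bound for each superlevel set; the powers of their measures add up to
  \<open>lorentz_layer\<close>.\<close>

lemma nn_integral_hl_root_le:
  assumes g [measurable]: "g \<in> borel_measurable borel" and [measurable]: "S \<in> sets borel"
    and s: "emeasure lborel S = ennreal s" "0 < s" and e: "0 < e" "e \<le> 1 / 2"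
  shows "(\<integral>\<^sup>+x\<in>S. hl_root g x \<partial>lborel) \<le> ennreal (6 * s powr (1 - e)) * lorentz_layer e g"
proof -
  let ?G = "\<lambda>l. {y. ennreal l < g y}"
  have [measurable]: "(\<lambda>(x, l). sqrt_hl_max (?G l) x) \<in> borel_measurable (lborel \<Otimes>\<^sub>M lborel)"
    using borel_measurable_hl_root(2)[OF g] by (simp cong: measurable_cong_sets sets_pair_measure_cong)
  have "(\<integral>\<^sup>+x\<in>S. hl_root g x \<partial>lborel)
      = (\<integral>\<^sup>+x. \<integral>\<^sup>+l. sqrt_hl_max (?G l) x * indicator {0..} l * indicator S x \<partial>lborel \<partial>lborel)"
    unfolding hl_root_def by (intro nn_integral_cong nn_integral_multc[symmetric]) measurable
  also have "\<dots> = (\<integral>\<^sup>+l. \<integral>\<^sup>+x. sqrt_hl_max (?G l) x * indicator {0..} l * indicator S x \<partial>lborel \<partial>lborel)"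
    by (rule lborel_pair.Fubini') measurable
  also have "\<dots> \<le> (\<integral>\<^sup>+l. ennreal (6 * s powr (1 - e)) * (ennreal_powr (distribution_fun lborel g (ennreal l)) e * indicator {0..} l) \<partial>lborel)"
  proof (rule nn_integral_mono)
    fix l :: real
    have "(\<integral>\<^sup>+x\<in>S. sqrt_hl_max (?G l) x \<partial>lborel) \<le> ennreal (6 * s powr (1 - e)) * ennreal_powr (emeasure lborel (?G l)) e"
      by (rule nn_integral_sqrt_hl_max_le[OF _ _ s e]) measurable
    then show "(\<integral>\<^sup>+x. sqrt_hl_max (?G l) x * indicator {0..} l * indicator S x \<partial>lborel)
      \<le> ennreal (6 * s powr (1 - e)) * (ennreal_powr (distribution_fun lborel g (ennreal l)) e * indicator {0..} l)"
      by (cases "0 \<le> l") (auto simp: distribution_fun_def)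
  qed
  also have "\<dots> = ennreal (6 * s powr (1 - e)) * lorentz_layer e g"
    unfolding lorentz_layer_def by (rule nn_integral_cmult) measurable
  finally show ?thesis .
qed

text \<open>Truncate to \<open>{- n..n}\<close> and use continuity from below. The Kolmogorov bound
  applies to sets of finite measure only, while a superlevel set might have infinite
  measure.\<close>

lemma obtain_finite_measure_subset:
  fixes T :: "real set"
  assumes [measurable]: "T \<in> sets borel" and t: "ennreal t < emeasure lborel T" "0 \<le> t"
  obtains S s where "S \<subseteq> T" "S \<in> sets borel" "emeasure lborel S = ennreal s" "t < s"
proof -
  have "(SUP n::nat. emeasure lborel (T \<inter> {- real n..real n})) = emeasure lborel (\<Union>n. T \<inter> {- real n..real n})"
    by (rule SUP_emeasure_incseq) (auto simp: incseq_def)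
  also have "(\<Union>n. T \<inter> {- real n..real n}) = T"
  proof (intro equalityI subsetI)
    fix x assume "x \<in> T"
    obtain n where "\<bar>x\<bar> \<le> real n"
      using real_arch_simple by blast
    then have "x \<in> {- real n..real n}"
      by auto
    with \<open>x \<in> T\<close> show "x \<in> (\<Union>n. T \<inter> {- real n..real n})"
      by (intro UN_I[of n UNIV] IntI) simp_all
  qed auto
  finally have "ennreal t < (SUP n::nat. emeasure lborel (T \<inter> {- real n..real n}))"
    using t(1) by simp
  then obtain n where n: "ennreal t < emeasure lborel (T \<inter> {- real n..real n})" (is "_ < emeasure _ ?S")
    unfolding less_SUP_iff by auto
  have "emeasure lborel ?S \<le> emeasure lborel {- real n..real n}"
    by (rule emeasure_mono) auto
  also have "\<dots> < \<top>" by simp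
  finally have fin: "emeasure lborel ?S = ennreal (enn2real (emeasure lborel ?S))"
    by simp
  moreover have "t < enn2real (emeasure lborel ?S)"
    using n t(2) by (subst (asm) fin) (simp add: ennreal_less_iff)
  ultimately show thesis
    by (intro that[of ?S]) auto
qed

text \<open>Let \<open>D\<close> be the layer integral. If the superlevel set had measure above
  \<open>t\<close>, it would contain some \<open>S\<close> of finite measure \<open>s > t\<close>.
  The integral over \<open>S\<close> would be at least \<open>6 * D * t powr - e * s\<close> and at
  most \<open>6 * D * s powr (1 - e)\<close>, so \<open>t powr - e \<le> s powr - e\<close>, against
  \<open>t < s\<close> and \<open>0 < e\<close>.\<close>

lemma hl_root_weak_type:
  assumes [measurable]: "g \<in> borel_measurable borel" and e: "0 < e" "e \<le> 1 / 2" and t: "0 < t"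
  shows "emeasure lborel {x. 6 * lorentz_layer e g * ennreal (t powr - e) < hl_root g x} \<le> ennreal t"
    (is "emeasure _ ?T \<le> _")
proof (rule ccontr)
  assume "\<not> ?thesis"
  then have big: "ennreal t < emeasure lborel ?T" by simp
  have [measurable]: "?T \<in> sets borel" by measurable
  obtain S s where S: "S \<subseteq> ?T" and [measurable]: "S \<in> sets borel" and s: "emeasure lborel S = ennreal s" "t < s"
    using obtain_finite_measure_subset[OF _ big] t by auto
  have s0: "0 < s" using s t by simp
  have upper: "(\<integral>\<^sup>+x\<in>S. hl_root g x \<partial>lborel) \<le> ennreal (6 * s powr (1 - e)) * lorentz_layer e g"
    by (rule nn_integral_hl_root_le[OF _ _ s(1) s0 e]) measurable
  show False
  proof (cases "lorentz_layer e g" rule: ennreal_cases)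
    case top
    then have "?T = {}" using t by (auto simp: ennreal_mult_top ennreal_top_mult)
    then show False using big by simp
  next
    case (real D)
    show False
    proof (cases "D = 0")
      \<comment> \<open>\<open>hl_root g\<close> is strictly positive on \<open>S\<close>, so a
        vanishing integral forces \<open>S\<close> to be null.\<close>
      case True
      then have "(\<integral>\<^sup>+x\<in>S. hl_root g x \<partial>lborel) = 0"
        using upper real by simp
      then have "emeasure lborel {x \<in> space lborel. hl_root g x * indicator S x \<noteq> 0} = 0"
        by (subst (asm) nn_integral_0_iff) auto
      moreover have "{x \<in> space lborel. hl_root g x * indicator S x \<noteq> 0} = S"
        using S by (auto split: split_indicator simp: indicator_def)
      ultimately show False using s s0 by simp
    next
      case False
      with real have D: "0 < D" by simp
      have "ennreal (6 * D * t powr - e * s) = (\<integral>\<^sup>+x. ennreal (6 * D * t powr - e) * indicator S x \<partial>lborel)"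
        using D s s0 by (simp add: nn_integral_cmult_indicator ennreal_mult)
      also have "\<dots> \<le> (\<integral>\<^sup>+x\<in>S. hl_root g x \<partial>lborel)"
      proof (rule nn_integral_mono)
        fix x
        have "6 * lorentz_layer e g * ennreal (t powr - e) = ennreal (6 * D * t powr - e)"
          using real D by (simp add: ennreal_mult)
        then show "ennreal (6 * D * t powr - e) * indicator S x \<le> hl_root g x * indicator S x"
          using S by (auto split: split_indicator)
      qed
      also have "\<dots> \<le> ennreal (6 * s powr (1 - e) * D)"
        using upper real by (simp add: ennreal_mult)
      finally have "6 * D * t powr - e * s \<le> 6 * s powr (1 - e) * D"
        using D s0 by (subst (asm) ennreal_le_iff) auto
      also have "s powr (1 - e) = s * s powr - e"
        using s0 powr_add[of s 1 "- e"] by simp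
      finally have "t powr - e \<le> s powr - e"
        using D s0 by (simp add: mult_ac)
      moreover have "s powr - e < t powr - e"
        using s t e by (intro powr_less_mono2_neg) auto
      ultimately show False by simp
    qed
  qed
qed

text \<open>The weak type inequality at the level \<open>6 * I / t\<close>, with \<open>I\<close>
  the integral of \<open>g\<close>, cast in the form of the bound for \<open>hl_root\<close> with
  \<open>e = 1\<close> and the same constant 6, so that all factors can be multiplied in one
  lemma.\<close>

lemma hl_max_weak_type':
  assumes [measurable]: "g \<in> borel_measurable borel" and t: "0 < t"
  shows "emeasure lborel {x. 6 * (\<integral>\<^sup>+y. g y \<partial>lborel) * ennreal (t powr - 1) < hl_max g x} \<le> ennreal t"
    (is "emeasure _ ?T \<le> _")
proof (cases "\<integral>\<^sup>+y. g y \<partial>lborel" rule: ennreal_cases)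
  case top
  then have "?T = {}" using t by (auto simp: ennreal_mult_top ennreal_top_mult)
  then show ?thesis by simp
next
  case (real I)
  show ?thesis
  proof (cases "I = 0")
    case True
    then have "?T = {}" using real hl_max_eq_0[of g] by auto
    then show ?thesis by simp
  next
    case False
    with real have I: "0 < I" by simp
    let ?a = "6 * I / t"
    have a: "0 < ?a" using I t by simp
    have "ennreal ?a = ennreal (6 * I) * ennreal (1 / t)"
      using I t by (subst ennreal_mult[symmetric]) auto
    also have "ennreal (6 * I) = 6 * ennreal I"
      using I by (simp add: ennreal_mult)
    finally have T: "?T = {x. ennreal ?a < hl_max g x}"
      using real t by (simp add: powr_minus_divide)
    have "ennreal ?a * emeasure lborel ?T \<le> 5 * ennreal I"
      unfolding T using hl_max_weak_type[OF _ a, of g] real by simp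
    also have "5 * ennreal I = ennreal (5 * I)"
      using I by (simp add: ennreal_mult)
    also have "\<dots> \<le> ennreal (?a * t)"
      using I t by (intro ennreal_leI) simp
    also have "\<dots> = ennreal ?a * ennreal t"
      using I t by (intro ennreal_mult) auto
    finally show ?thesis
      using a by (subst (asm) ennreal_mult_le_mult_iff) auto
  qed
qed

text \<open>Levels above the essential supremum have null superlevel sets and contribute nothing;
  every other level contributes at most 1. This serves the endpoint
  \<open>p = \<infinity>\<close>.\<close>

lemma hl_root_le_esssup:
  assumes [measurable]: "g \<in> borel_measurable borel"
  shows "hl_root g x \<le> esssup lborel g"
proof (cases "esssup lborel g" rule: ennreal_cases)
  case (real s)
  have "hl_root g x \<le> (\<integral>\<^sup>+l. indicator {0..s} l \<partial>lborel)"
    unfolding hl_root_def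
  proof (rule nn_integral_mono)
    fix l :: real
    show "sqrt_hl_max {y. ennreal l < g y} x * indicator {0..} l \<le> indicator {0..s} l"
    proof (cases "0 \<le> l \<and> s < l")
      case True
      then have "AE y in lborel. \<not> ennreal l < g y"
        using esssup_AE[of g lborel] real
        by (auto elim!: eventually_mono simp: not_less intro: order_trans[OF _ ennreal_leI])
      then have "emeasure lborel {y \<in> space lborel. ennreal l < g y} = 0"
        by (subst (asm) AE_iff_measurable[OF _ refl]) auto
      then have "sqrt_hl_max {y. ennreal l < g y} x = 0"
        by (intro sqrt_hl_max_null) auto
      then show ?thesis by simp
    next
      case False
      then show ?thesis
        using sqrt_hl_max_le_1[of _ x] by (auto split: split_indicator)
    qed
  qed
  then show ?thesis using real by simp
qed simp

text \<open>For finite \<open>d\<close> the weight \<open>t powr (e - 1)\<close> is nonincreasing,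
  hence at least \<open>d powr (e - 1)\<close> on an interval of length \<open>d\<close>. Infinite
  \<open>d\<close> is reached through the finite values \<open>n powr (1 / e)\<close>.\<close>

lemma ennreal_powr_le_nn_integral:
  assumes e: "0 < e" "e \<le> 1"
  shows "ennreal_powr d e \<le> (\<integral>\<^sup>+t. (if 0 < t \<and> ennreal t < d then ennreal (t powr (e - 1)) else 0) \<partial>lborel)"
    (is "_ \<le> ?R d")
proof -
  have fin: "ennreal (r powr e) \<le> ?R (ennreal r)" if r: "0 < r" for r
  proof -
    have "ennreal (r powr e) = (\<integral>\<^sup>+t. ennreal (r powr (e - 1)) * indicator {0<..<r} t \<partial>lborel)"
    proof -
      have "r powr e = r powr (e - 1) * r"
        using r powr_add[of r "e - 1" 1] by simp
      then show ?thesis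
        using r by (simp add: nn_integral_cmult_indicator ennreal_mult)
    qed
    also have "\<dots> \<le> ?R (ennreal r)"
    proof (rule nn_integral_mono)
      fix t
      show "ennreal (r powr (e - 1)) * indicator {0<..<r} t \<le> (if 0 < t \<and> ennreal t < ennreal r then ennreal (t powr (e - 1)) else 0)"
      proof (cases "0 < t \<and> t < r")
        case True
        then have "r powr (e - 1) \<le> t powr (e - 1)"
          using e by (intro powr_mono2') auto
        then show ?thesis using True by (simp add: ennreal_less_iff ennreal_leI)
      qed (auto split: split_indicator)
    qed
    finally show ?thesis .
  qed
  show ?thesis
  proof (cases d rule: ennreal_cases)
    case (real r)
    then show ?thesis
      using fin[of r] by (cases "r = 0") (auto simp: ennreal_powr_def)
  next
    case top
    have "of_nat n \<le> ?R d" for n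
    proof (cases "n = 0")
      case False
      have "ennreal ((real n powr (1 / e)) powr e) \<le> ?R (ennreal (real n powr (1 / e)))"
        using False by (intro fin) simp
      also have "\<dots> \<le> ?R d"
        using top by (intro nn_integral_mono) auto
      finally show ?thesis
        using e by (simp add: powr_powr ennreal_of_nat_eq_real_of_nat)
    qed simp
    then have "?R d = \<top>"
      by (meson ennreal_Ex_less_of_nat leD not_less top.not_eq_extremum)
    then show ?thesis by simp
  qed
qed

text \<open>Expand the power of the distribution function as an integral over \<open>t\<close> and
  exchange the order. For fixed \<open>t\<close>, the levels at which the distribution function
  exceeds \<open>t\<close> lie below the rearrangement at \<open>t\<close>, and the weight
  \<open>t powr (1 / r - 1)\<close> is that of the Lorentz norm with second exponent 1.\<close>

lemma lorentz_layer_le_lorentz_norm: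
  assumes [measurable]: "g \<in> borel_measurable borel" and r: "1 \<le> r"
  shows "lorentz_layer (1 / r) g \<le> lorentz_norm lborel (ennreal r) 1 g"
proof -
  let ?d = "\<lambda>l. distribution_fun lborel g (ennreal l)"
  have e: "0 < 1 / r" "1 / r \<le> 1" using r by auto
  have rearr: "(\<integral>\<^sup>+l. (if 0 \<le> l \<and> ennreal t < ?d l then 1 else 0) \<partial>lborel) \<le> decreasing_rearrangement lborel g t" (is "?L \<le> ?s") for t
  proof (cases ?s rule: ennreal_cases)
    case (real s)
    have "?L \<le> (\<integral>\<^sup>+l. indicator {0..s} l \<partial>lborel)"
    proof (rule nn_integral_mono)
      fix l :: real
      have "l \<le> s" if "0 \<le> l" "ennreal t < ?d l"
      proof -
        have "ennreal l \<le> ?s"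
          unfolding decreasing_rearrangement_def
        \<comment> \<open>An admissible \<open>a\<close> below \<open>l\<close> would give
          \<open>?d l \<le> ennreal t\<close>, since the distribution function is
          nonincreasing.\<close>
        proof (rule Inf_greatest, rule ccontr)
          fix a assume a: "a \<in> {a. distribution_fun lborel g a \<le> ennreal t}" "\<not> ennreal l \<le> a"
          then have "?d l \<le> distribution_fun lborel g a"
            unfolding distribution_fun_def by (intro emeasure_mono) auto
          with a that show False by auto
        qed
        then show ?thesis using real by simp
      qed
      then show "(if 0 \<le> l \<and> ennreal t < ?d l then 1 else 0) \<le> (indicator {0..s} l :: ennreal)"
        by auto
    qed
    then show ?thesis using real by simp
  qed simp
  have "lorentz_layer (1 / r) g
      \<le> (\<integral>\<^sup>+l. \<integral>\<^sup>+t. (if 0 < t \<and> 0 \<le> l \<and> ennreal t < ?d l then ennreal (t powr (1 / r - 1)) else 0) \<partial>lborel \<partial>lborel)"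
    unfolding lorentz_layer_def
  proof (rule nn_integral_mono)
    fix l :: real
    show "ennreal_powr (?d l) (1 / r) * indicator {0..} l
      \<le> (\<integral>\<^sup>+t. (if 0 < t \<and> 0 \<le> l \<and> ennreal t < ?d l then ennreal (t powr (1 / r - 1)) else 0) \<partial>lborel)"
      using ennreal_powr_le_nn_integral[OF e, of "?d l"] by (cases "0 \<le> l") auto
  qed
  also have "\<dots> = (\<integral>\<^sup>+t. \<integral>\<^sup>+l. (if 0 < t \<and> 0 \<le> l \<and> ennreal t < ?d l then ennreal (t powr (1 / r - 1)) else 0) \<partial>lborel \<partial>lborel)"
    by (rule lborel_pair.Fubini') measurable
  also have "\<dots> \<le> (\<integral>\<^sup>+t\<in>{0<..}. ennreal (t powr (1 / r)) * decreasing_rearrangement lborel g t * ennreal (1 / t) \<partial>lborel)"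
  proof (rule nn_integral_mono)
    fix t :: real
    show "(\<integral>\<^sup>+l. (if 0 < t \<and> 0 \<le> l \<and> ennreal t < ?d l then ennreal (t powr (1 / r - 1)) else 0) \<partial>lborel)
      \<le> ennreal (t powr (1 / r)) * decreasing_rearrangement lborel g t * ennreal (1 / t) * indicator {0<..} t"
    proof (cases "0 < t")
      case True
      have "(\<integral>\<^sup>+l. (if 0 < t \<and> 0 \<le> l \<and> ennreal t < ?d l then ennreal (t powr (1 / r - 1)) else 0) \<partial>lborel)
        = (\<integral>\<^sup>+l. ennreal (t powr (1 / r - 1)) * (if 0 \<le> l \<and> ennreal t < ?d l then 1 else 0) \<partial>lborel)"
        using True by (intro nn_integral_cong) auto
      also have "\<dots> = ennreal (t powr (1 / r - 1)) * (\<integral>\<^sup>+l. (if 0 \<le> l \<and> ennreal t < ?d l then 1 else 0) \<partial>lborel)"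
        by (rule nn_integral_cmult) measurable
      also have "\<dots> \<le> ennreal (t powr (1 / r - 1)) * decreasing_rearrangement lborel g t"
        by (intro mult_left_mono rearr) simp
      also have "\<dots> = ennreal (t powr (1 / r)) * decreasing_rearrangement lborel g t * ennreal (1 / t)"
      proof -
        have "ennreal (t powr (1 / r - 1)) = ennreal (t powr (1 / r)) * ennreal (1 / t)"
          using True by (simp add: powr_diff ennreal_mult[symmetric])
        then show ?thesis by (simp add: mult_ac)
      qed
      finally show ?thesis using True by simp
    qed simp
  qed
  also have "\<dots> = lorentz_norm lborel (ennreal r) 1 g"
  proof -
    have 1: "ennreal_powr a 1 = a" for a
      by (cases a rule: ennreal_cases) (auto simp: ennreal_powr_def)
    show ?thesis
      using r unfolding lorentz_norm_def by (simp add: 1)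
  qed
  finally show ?thesis .
qed

text \<open>Tonelli on the region under the graph of \<open>g\<close>. Together with the comparison
  at \<open>r = 1\<close> it bounds the integral in the weak type inequality for
  \<open>hl_max\<close> by the Lorentz norm.\<close>

lemma lorentz_layer_1:
  assumes [measurable]: "g \<in> borel_measurable borel"
  shows "lorentz_layer 1 g = (\<integral>\<^sup>+y. g y \<partial>lborel)"
proof -
  have 1: "ennreal_powr a 1 = a" for a
    by (cases a rule: ennreal_cases) (auto simp: ennreal_powr_def)
  have "(\<integral>\<^sup>+y. g y \<partial>lborel) = (\<integral>\<^sup>+y. \<integral>\<^sup>+l. (if 0 \<le> l \<and> ennreal l < g y then 1 else 0) \<partial>lborel \<partial>lborel)"
  proof (rule nn_integral_cong)
    fix y
    have "g y = (\<integral>\<^sup>+l\<in>{0..}. indicator {y. ennreal l < g y} y \<partial>lborel)"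
      by (simp only: nn_integral_superlevel)
    also have "\<dots> = (\<integral>\<^sup>+l. (if 0 \<le> l \<and> ennreal l < g y then 1 else 0) \<partial>lborel)"
      by (intro nn_integral_cong) (auto split: split_indicator)
    finally show "g y = (\<integral>\<^sup>+l. (if 0 \<le> l \<and> ennreal l < g y then 1 else 0) \<partial>lborel)" .
  qed
  also have "\<dots> = (\<integral>\<^sup>+l. \<integral>\<^sup>+y. (if 0 \<le> l \<and> ennreal l < g y then 1 else 0) \<partial>lborel \<partial>lborel)"
    by (rule lborel_pair.Fubini') measurable
  also have "\<dots> = lorentz_layer 1 g"
    unfolding lorentz_layer_def
  proof (rule nn_integral_cong)
    fix l :: real
    have "(\<integral>\<^sup>+y. (if 0 \<le> l \<and> ennreal l < g y then 1 else 0) \<partial>lborel)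
      = (\<integral>\<^sup>+y. indicator {y \<in> space lborel. ennreal l < g y} y \<partial>lborel) * indicator {0..} l"
      unfolding indicator_def by (cases "0 \<le> l") (simp_all add: of_bool_def)
    also have "\<dots> = ennreal_powr (distribution_fun lborel g (ennreal l)) 1 * indicator {0..} l"
      unfolding distribution_fun_def 1 by (subst nn_integral_indicator) auto
    finally show "(\<integral>\<^sup>+y. (if 0 \<le> l \<and> ennreal l < g y then 1 else 0) \<partial>lborel)
      = ennreal_powr (distribution_fun lborel g (ennreal l)) 1 * indicator {0..} l" .
  qed
  finally show ?thesis by simp
qed

text \<open>Hoelder's inequality for weak spaces: the measure \<open>t\<close> is shared equally
  among the \<open>n\<close> factors, which costs \<open>n\<close> to the sum of the exponents. For
  \<open>e i = 0\<close> the level \<open>B i\<close> does not depend on \<open>s\<close>, so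
  bounded factors are included.\<close>

lemma weak_type_product_le:
  fixes G :: "'m::finite \<Rightarrow> real \<Rightarrow> ennreal" and e :: "'m \<Rightarrow> real"
  assumes [measurable]: "\<And>i. G i \<in> borel_measurable borel"
    and weak: "\<And>i s. 0 < s \<Longrightarrow> emeasure lborel {x. B i * ennreal (s powr - e i) < G i x} \<le> ennreal s"
    and H: "\<And>x. H x \<le> C * (\<Prod>i\<in>UNIV. G i x)"
    and q: "q \<noteq> \<infinity>" "1 / enn2real q = (\<Sum>i\<in>UNIV. e i)"
  shows "lorentz_norm lborel q \<infinity> H \<le> ennreal (real CARD('m) powr (\<Sum>i\<in>UNIV. e i)) * C * (\<Prod>i\<in>UNIV. B i)"
proof -
  let ?n = "real CARD('m)" and ?e = "\<Sum>i\<in>UNIV. e i"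
  have n: "0 < ?n" by simp
  have "ennreal (t powr ?e) * decreasing_rearrangement lborel H t \<le> ennreal (?n powr ?e) * C * (\<Prod>i\<in>UNIV. B i)"
    if t: "0 < t" for t
  proof -
    \<comment> \<open>If \<open>H\<close> exceeds \<open>a\<close>, some factor \<open>G i\<close> exceeds a level that it passes only on a set of measure \<open>t / n\<close>.\<close>
    let ?s = "t / ?n"
    define a where "a = C * (\<Prod>i\<in>UNIV. B i * ennreal (?s powr - e i))"
    let ?T = "\<lambda>i. {x. B i * ennreal (?s powr - e i) < G i x}"
    have s: "0 < ?s" using t n by simp
    have sub: "{x \<in> space lborel. a < H x} \<subseteq> (\<Union>i. ?T i)"
    proof
      fix x assume "x \<in> {x \<in> space lborel. a < H x}"
      then have x: "a < H x" by simp
      show "x \<in> (\<Union>i. ?T i)"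
      proof (rule ccontr)
        assume "x \<notin> (\<Union>i. ?T i)"
        then have "G i x \<le> B i * ennreal (?s powr - e i)" for i by (auto simp: not_less)
        then have "C * (\<Prod>i\<in>UNIV. G i x) \<le> a"
          unfolding a_def by (intro mult_left_mono prod_mono_ennreal) auto
        then show False using H[of x] x by (meson leD order_trans)
      qed
    qed
    have "distribution_fun lborel H a \<le> emeasure lborel (\<Union>i. ?T i)"
      unfolding distribution_fun_def by (rule emeasure_mono[OF sub]) measurable
    also have "\<dots> \<le> (\<Sum>i\<in>UNIV. emeasure lborel (?T i))"
      by (rule emeasure_subadditive_finite) auto
    also have "\<dots> \<le> (\<Sum>i\<in>(UNIV :: 'm set). ennreal ?s)"
      by (intro sum_mono weak s)
    also have "\<dots> = ennreal t"
      using t n by (simp add: sum_ennreal del: sum_constant) simp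
    finally have "decreasing_rearrangement lborel H t \<le> a"
      unfolding decreasing_rearrangement_def by (intro Inf_lower) simp
    then have "ennreal (t powr ?e) * decreasing_rearrangement lborel H t \<le> ennreal (t powr ?e) * a"
      by (rule mult_left_mono) simp
    also have "a = C * (\<Prod>i\<in>UNIV. B i) * ennreal (?s powr - ?e)"
    proof -
      have "(\<Prod>i\<in>UNIV. ennreal (?s powr - e i)) = ennreal (?s powr - ?e)"
        using t powr_sum[of ?s "\<lambda>i. - e i" UNIV] by (simp add: prod_ennreal sum_negf)
      then show ?thesis by (simp add: a_def prod.distrib mult.assoc)
    qed
    also have "ennreal (t powr ?e) * (C * (\<Prod>i\<in>UNIV. B i) * ennreal (?s powr - ?e))
        = (ennreal (t powr ?e) * ennreal (?s powr - ?e)) * C * (\<Prod>i\<in>UNIV. B i)"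
      by (simp add: mult_ac)
    also have "ennreal (t powr ?e) * ennreal (?s powr - ?e) = ennreal (?n powr ?e)"
      using t n by (simp add: ennreal_mult[symmetric] powr_minus powr_divide)
    finally show ?thesis .
  qed
  then show ?thesis
    using q by (auto simp: lorentz_norm_def intro!: SUP_least)
qed

section \<open>Assembly on the segment of exponents\<close>

lemma schwartz_borel_measurable:
  assumes "schwartz f"
  shows "f \<in> borel_measurable borel"
proof -
  obtain D where "D 0 = f" and D: "\<And>n x. (D n has_vector_derivative D (Suc n) x) (at x)"
    using assms unfolding schwartz_def by blast
  then have "continuous_on UNIV f"
    by (metis continuous_at_imp_continuous_on has_vector_derivative_continuous)
  then show ?thesis
    by (rule borel_measurable_continuous_onI)
qed

theorem corollary1p3:
  fixes p :: "'m::finite \<Rightarrow> ennreal" and q :: ennreal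
  assumes "CARD('m) \<ge> 2"
    and "\<And>i. 1 \<le> p i"
    and "1 / q = (\<Sum>i\<in>UNIV. 1 / p i)"
    and "\<exists>j k. j \<noteq> k \<and> (\<lambda>i. 1 / p i) \<in> exponent_segment k j"
  shows "\<exists>C>0. \<forall>f :: 'm \<Rightarrow> real \<Rightarrow> complex. (\<forall>i. schwartz (f i)) \<longrightarrow>
           lorentz_norm lborel q \<infinity> (spherical_maximal f)
             \<le> ennreal C * (\<Prod>i\<in>UNIV. lorentz_norm lborel (p i) 1 (\<lambda>x. ennreal (cmod (f i x))))"
proof -
  obtain j k where jk: "j \<noteq> k" and seg: "1 / p k \<le> 1 / 2" "1 / p j = 1 / 2"
    "\<And>i. i \<noteq> k \<Longrightarrow> i \<noteq> j \<Longrightarrow> 1 / p i = 1"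
    using assms(4) unfolding exponent_segment_def by auto
  \<comment> \<open>The reciprocal exponents as real numbers; \<open>e i\<close> is 0 exactly when
    \<open>p i\<close> is infinite.\<close>
  define e where "e i = enn2real (1 / p i)" for i
  have inv_p: "1 / p i = ennreal (1 / r)" "1 \<le> r" if "p i = ennreal r" "0 \<le> r" for i r
  proof -
    show "1 \<le> r"
      using assms(2)[of i] that by (simp add: ennreal_1[symmetric] del: ennreal_1)
    then show "1 / p i = ennreal (1 / r)"
      using divide_ennreal[of 1 r] that by simp
  qed
  have inv_le: "1 / p i \<le> 1" for i
  proof (cases "p i" rule: ennreal_cases)
    case (real r)
    then show ?thesis
      using inv_p[of i r] by (simp add: ennreal_1[symmetric] del: ennreal_1)
  qed simp
  have e: "1 / p i = ennreal (e i)" "0 \<le> e i" "e i \<le> 1" for i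
    using inv_le[of i] enn2real_mono[OF inv_le[of i]] le_less_trans[OF inv_le[of i] ennreal_one_less_top]
    by (auto simp: e_def)
  have p_eq: "p i = ennreal (1 / e i)" if "0 < e i" for i
  proof (cases "p i" rule: ennreal_cases)
    case (real r)
    then have "e i = 1 / r"
      unfolding e_def using inv_p[of i r] by simp
    then show ?thesis using real by simp
  next
    case top
    then show ?thesis using that by (simp add: e_def)
  qed
  have p_top: "p i = \<infinity>" if "e i = 0" for i
    using e(1)[of i] that by (simp add: ennreal_divide_eq_0_iff)
  have half: "(1 / 2 :: ennreal) = ennreal (1 / 2)"
    using divide_ennreal[of 1 2] by simp
  have ej: "e j = 1 / 2"
  proof -
    have "ennreal (e j) = ennreal (1 / 2)"
      by (simp only: e(1)[symmetric] seg(2) half)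
    then show ?thesis
      by (subst (asm) ennreal_inj) (auto simp: e)
  qed
  have ek: "e k \<le> 1 / 2"
  proof -
    have "ennreal (e k) \<le> ennreal (1 / 2)"
      using seg(1) by (simp only: e(1) half)
    then show ?thesis
      by (subst (asm) ennreal_le_iff) auto
  qed
  have ei: "e i = 1" if "i \<noteq> k" "i \<noteq> j" for i using seg(3)[OF that] by (simp add: e_def)
  have sum_e: "(\<Sum>i\<in>UNIV. 1 / p i) = ennreal (\<Sum>i\<in>UNIV. e i)"
    by (simp add: e sum_ennreal)
  \<comment> \<open>The coordinate \<open>j\<close> alone contributes 1/2, so \<open>q\<close> is
    finite and its weak norm is the supremum branch of \<open>lorentz_norm\<close>.\<close>
  have "e j \<le> (\<Sum>i\<in>UNIV. e i)"
    by (intro member_le_sum) (auto simp: e)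
  then have sum_pos: "0 < (\<Sum>i\<in>UNIV. e i)" using ej by simp
  have q_inv: "1 / q = ennreal (\<Sum>i\<in>UNIV. e i)" using assms(3) sum_e by simp
  have q: "q \<noteq> \<infinity>" "1 / enn2real q = (\<Sum>i\<in>UNIV. e i)"
  proof -
    show "q \<noteq> \<infinity>" using q_inv sum_pos by auto
    then obtain r where r: "q = ennreal r" "0 \<le> r" by (cases q rule: ennreal_cases) auto
    have "r \<noteq> 0" using q_inv r by (auto simp: ennreal_divide_zero)
    then have "ennreal (1 / r) = ennreal (\<Sum>i\<in>UNIV. e i)"
      using q_inv r divide_ennreal[of 1 r] by simp
    then show "1 / enn2real q = (\<Sum>i\<in>UNIV. e i)"
      using r sum_pos by simp
  qed
  define C where "C = 48 * 4 ^ CARD('m) / emeasure lborel (cball (0 :: real ^ 'm) 1)"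
  \<comment> \<open>The first factor is the loss in the weak Hoelder inequality; the power of 6
    collects one constant 6 from each weak type bound.\<close>
  define K where "K = ennreal (real CARD('m) powr (\<Sum>i\<in>UNIV. e i)) * C * 6 ^ CARD('m)"
  have "C < \<top>"
  proof -
    obtain v where v: "emeasure lborel (cball (0 :: real ^ 'm) 1) = ennreal v" "0 < v"
      using emeasure_unit_cball[where 'a = "real ^ 'm"]
      by (cases "emeasure lborel (cball (0 :: real ^ 'm) 1)" rule: ennreal_cases) (auto simp: less_le)
    have "(48 * 4 ^ CARD('m) :: ennreal) = ennreal (48 * 4 ^ CARD('m))"
      by (simp add: ennreal_mult ennreal_power[symmetric])
    then have "C = ennreal (48 * 4 ^ CARD('m) / v)"
      unfolding C_def v(1) using v(2) by (simp add: divide_ennreal)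
    then show ?thesis by simp
  qed
  then have K: "K < \<top>"
    unfolding K_def by (auto simp: ennreal_mult_less_top power_less_top_ennreal)
  have bound: "lorentz_norm lborel q \<infinity> (spherical_maximal f)
      \<le> K * (\<Prod>i\<in>UNIV. lorentz_norm lborel (p i) 1 (\<lambda>x. ennreal (cmod (f i x))))"
    if f: "\<And>i. schwartz (f i)" for f :: "'m \<Rightarrow> real \<Rightarrow> complex"
  proof -
    have [measurable]: "f i \<in> borel_measurable borel" for i
      by (rule schwartz_borel_measurable[OF f])
    define g where "g i y = ennreal (cmod (f i y))" for i y
    have [measurable]: "g i \<in> borel_measurable borel" for i
      unfolding g_def by measurable
    define L where "L i = lorentz_norm lborel (p i) 1 (g i)" for i
    define G where "G i = (if i = j \<or> i = k then hl_root (g i) else hl_max (g i))" for i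
    have hl_max_meas: "hl_max (g i) \<in> borel_measurable borel" for i
      by (rule borel_measurable_hl_max) measurable
    have layer: "lorentz_layer (e i) (g i) \<le> L i" if "0 < e i" for i
      using lorentz_layer_le_lorentz_norm[of "g i" "1 / e i"] that e(3)[of i] p_eq[OF that]
      by (simp add: L_def)
    \<comment> \<open>Three regimes: circle coordinates with \<open>0 < e i \<le> 1 / 2\<close>, the
      coordinate \<open>k\<close> when \<open>p k\<close> is infinite, and frozen coordinates, where
      \<open>e i = 1\<close>.\<close>
    have weak: "emeasure lborel {x. 6 * L i * ennreal (s powr - e i) < G i x} \<le> ennreal s" if s: "0 < s" for i s
    proof -
      consider "i = j \<or> i = k" "0 < e i" | "i = j \<or> i = k" "e i = 0" | "i \<noteq> j" "i \<noteq> k"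
        using e(2)[of i] by linarith
      then show ?thesis
      proof cases
        case 1
        have "{x. 6 * L i * ennreal (s powr - e i) < G i x}
            \<subseteq> {x. 6 * lorentz_layer (e i) (g i) * ennreal (s powr - e i) < hl_root (g i) x}"
        proof
          fix x assume "x \<in> {x. 6 * L i * ennreal (s powr - e i) < G i x}"
          then have "6 * L i * ennreal (s powr - e i) < hl_root (g i) x"
            using 1 by (simp add: G_def)
          moreover have "6 * lorentz_layer (e i) (g i) * ennreal (s powr - e i) \<le> 6 * L i * ennreal (s powr - e i)"
            by (intro mult_right_mono mult_left_mono layer 1(2)) auto
          ultimately show "x \<in> {x. 6 * lorentz_layer (e i) (g i) * ennreal (s powr - e i) < hl_root (g i) x}"
            by (blast intro: le_less_trans)
        qed
        then have "emeasure lborel {x. 6 * L i * ennreal (s powr - e i) < G i x}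
            \<le> emeasure lborel {x. 6 * lorentz_layer (e i) (g i) * ennreal (s powr - e i) < hl_root (g i) x}"
          by (rule emeasure_mono) measurable
        also have "\<dots> \<le> ennreal s"
          using 1 ej ek s by (intro hl_root_weak_type) auto
        finally show ?thesis .
      next
        case 2
        have "hl_root (g i) x \<le> 6 * L i" for x
        proof -
          have "hl_root (g i) x \<le> 1 * L i"
            using hl_root_le_esssup[of "g i" x] p_top[OF 2(2)] by (simp add: L_def lorentz_norm_def)
          also have "\<dots> \<le> 6 * L i" by (intro mult_right_mono) auto
          finally show ?thesis .
        qed
        then have "{x. 6 * L i * ennreal (s powr - e i) < G i x} = {}"
          using 2 s by (auto simp: G_def not_less)
        then show ?thesis by simp
      next
        case 3
        have ei1: "e i = 1" by (rule ei[OF 3(2,1)])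
        have "{x. 6 * L i * ennreal (s powr - e i) < G i x}
            \<subseteq> {x. 6 * (\<integral>\<^sup>+y. g i y \<partial>lborel) * ennreal (s powr - 1) < hl_max (g i) x}"
        proof
          fix x assume "x \<in> {x. 6 * L i * ennreal (s powr - e i) < G i x}"
          then have "6 * L i * ennreal (s powr - 1) < hl_max (g i) x"
            using 3 by (simp add: G_def ei1)
          moreover have "6 * (\<integral>\<^sup>+y. g i y \<partial>lborel) * ennreal (s powr - 1) \<le> 6 * L i * ennreal (s powr - 1)"
            using layer[of i] ei1 lorentz_layer_1[of "g i"]
            by (intro mult_right_mono mult_left_mono) auto
          ultimately show "x \<in> {x. 6 * (\<integral>\<^sup>+y. g i y \<partial>lborel) * ennreal (s powr - 1) < hl_max (g i) x}"
            by (blast intro: le_less_trans)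
        qed
        then have "emeasure lborel {x. 6 * L i * ennreal (s powr - e i) < G i x}
            \<le> emeasure lborel {x. 6 * (\<integral>\<^sup>+y. g i y \<partial>lborel) * ennreal (s powr - 1) < hl_max (g i) x}"
          by (rule emeasure_mono) (use hl_max_meas in measurable)
        also have "\<dots> \<le> ennreal s"
          using s by (intro hl_max_weak_type') auto
        finally show ?thesis .
      qed
    qed
    have "lorentz_norm lborel q \<infinity> (spherical_maximal f)
      \<le> ennreal (real CARD('m) powr (\<Sum>i\<in>UNIV. e i)) * C * (\<Prod>i\<in>UNIV. 6 * L i)"
    proof (rule weak_type_product_le[OF _ weak _ q])
      show "G i \<in> borel_measurable borel" for i
        using hl_max_meas by (simp add: G_def)
      show "spherical_maximal f x \<le> C * (\<Prod>i\<in>UNIV. G i x)" for x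
      proof -
        have "(\<Prod>i\<in>UNIV. G i x) = G j x * (\<Prod>i\<in>UNIV - {j}. G i x)"
          by (rule prod.remove) auto
        also have "(\<Prod>i\<in>UNIV - {j}. G i x) = G k x * (\<Prod>i\<in>UNIV - {j} - {k}. G i x)"
          using jk by (intro prod.remove) auto
        also have "UNIV - {j} - {k} = UNIV - {j, k}" by auto
        also have "(\<Prod>i\<in>UNIV - {j, k}. G i x) = (\<Prod>i\<in>UNIV - {j, k}. hl_max (g i) x)"
          by (intro prod.cong) (auto simp: G_def)
        finally show ?thesis
          using spherical_maximal_le[of f j k x] jk
          by (simp add: C_def G_def g_def[abs_def] mult.assoc)
      qed
    qed
    also have "\<dots> = K * (\<Prod>i\<in>UNIV. L i)"
      by (simp add: K_def prod.distrib mult.assoc)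
    finally show ?thesis
      by (simp add: L_def g_def[abs_def])
  qed
  \<comment> \<open>Adding 1 yields a strictly positive real above \<open>K\<close>.\<close>
  define c where "c = enn2real K + 1"
  have c: "0 < c" "K \<le> ennreal c"
  proof -
    show "0 < c" by (simp add: c_def add_nonneg_pos)
    have "K = ennreal (enn2real K)" using K by simp
    also have "\<dots> \<le> ennreal c" by (intro ennreal_leI) (simp add: c_def)
    finally show "K \<le> ennreal c" .
  qed
  show ?thesis
  proof (intro exI[of _ c] conjI allI impI c(1))
    fix f :: "'m \<Rightarrow> real \<Rightarrow> complex" assume "\<forall>i. schwartz (f i)"
    then have "lorentz_norm lborel q \<infinity> (spherical_maximal f)
        \<le> K * (\<Prod>i\<in>UNIV. lorentz_norm lborel (p i) 1 (\<lambda>x. ennreal (cmod (f i x))))"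
      by (intro bound) simp
    also have "\<dots> \<le> ennreal c * (\<Prod>i\<in>UNIV. lorentz_norm lborel (p i) 1 (\<lambda>x. ennreal (cmod (f i x))))"
      by (rule mult_right_mono[OF c(2)]) simp
    finally show "lorentz_norm lborel q \<infinity> (spherical_maximal f)
        \<le> ennreal c * (\<Prod>i\<in>UNIV. lorentz_norm lborel (p i) 1 (\<lambda>x. ennreal (cmod (f i x))))" .
  qed
qed

end
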